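(* Let $(a,b)\in\{(2,2),(2,3),(2,4)\}$ and let $T\in\mathbb{C}^{a+1}\otimes\mathbb{C}^{b+1}\otimes\mathbb{C}^{a+b+2}$ be a general tensor. Then $\langle Z_T\rangle\subsetneq\mathbb{P}(H_T)$.
   Context: Everything is over $\mathbb{C}$. "General" means: for all $T$ in some nonempty Zariski open subset of the tensor space. Let $V=V_1\otimes\cdots\otimes V_m$ with $\dim V_i=n_i+1$ (here $m=3$), each $V_i$ equipped with the complexification of a positive definite real quadratic form; use orthonormal coordinates, so that $V_i$ is identified with its dual. A singular vector $m$-tuple of $T=(t_{i_1\cdots i_m})\in V$ is a tuple $(\mathbf{x}_1,\dots,\mathbf{x}_m)$ of nonzero vectors $\mathbf{x}_i\in V_i$ such that for every $i$ the contraction $T(\mathbf{x}_1\otimes\cdots\otimes\widehat{\mathbf{x}_i}\otimes\cdots\otimes\mathbf{x}_m)\in V_i$ and $\mathbf{x}_i$ are linearly dependent. $Z_T\subset\mathbb{P}(V)$ is the set of points $[\mathbf{x}_1\otimes\cdots\otimes\mathbf{x}_m]$ with $(\mathbf{x}_i)_i$ a singular vector $m$-tuple of $T$; $\langle Z_T\rangle$ is its projective linear span. The critical space $H_T\subset V$ is the linear subspace of all $z=(z_{i_1\cdots i_m})$ such that for all $\ell$ and all $1\le p<q\le n_\ell+1$, $\sum\left(t_{i_1\cdots p\cdots i_m}z_{i_1\cdots q\cdots i_m}-t_{i_1\cdots q\cdots i_m}z_{i_1\cdots p\cdots i_m}\right)=0$ ($p,q$ in position $\ell$, sum over the other indices).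 *)

theory Defs
  imports "HOL-Analysis.Analysis"
begin

text \<open>
  A tensor in \<open>V\<^sub>1 \<otimes> V\<^sub>2 \<otimes> V\<^sub>3\<close> is its coordinate array with respect to orthonormal bases of the
  factors, i.e. a vector indexed by a product of three finite types. The complex linear structure
  is that of \<open>(*s)\<close>, so linear span and subspace are \<open>vec.span\<close> and \<open>vec.subspace\<close>.
\<close>

type_synonym ('i, 'j, 'k) tensor = "complex ^ ('i \<times> 'j \<times> 'k)"

inductive polynomial_fun :: "(complex ^ 'n \<Rightarrow> complex) \<Rightarrow> bool" where
  const: "polynomial_fun (\<lambda>v. c)"
| coord: "polynomial_fun (\<lambda>v. v $ i)"
| add: "polynomial_fun f \<Longrightarrow> polynomial_fun g \<Longrightarrow> polynomial_fun (\<lambda>v. f v + g v)"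
| mult: "polynomial_fun f \<Longrightarrow> polynomial_fun g \<Longrightarrow> polynomial_fun (\<lambda>v. f v * g v)"

definition zariski_closed :: "(complex ^ 'n) set \<Rightarrow> bool" where
  "zariski_closed X \<longleftrightarrow>
     (\<exists>F. (\<forall>f\<in>F. polynomial_fun f) \<and> X = {v. \<forall>f\<in>F. f v = 0})"

definition zariski_open :: "(complex ^ 'n) set \<Rightarrow> bool" where
  "zariski_open U \<longleftrightarrow> zariski_closed (- U)"

definition holds_for_general :: "(complex ^ 'n \<Rightarrow> bool) \<Rightarrow> bool" where
  "holds_for_general P \<longleftrightarrow> (\<exists>U. zariski_open U \<and> U \<noteq> {} \<and> (\<forall>v\<in>U. P v))"

text \<open>
  Points of a projective space are lines through the origin; \<open>proj_subspace W\<close> is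
  \<open>\<P>(W)\<close> as a set of points of \<open>\<P>(V)\<close>.
\<close>

definition proj_point :: "complex ^ 'n \<Rightarrow> (complex ^ 'n) set" where
  "proj_point v = vec.span {v}"

definition proj_subspace :: "(complex ^ 'n) set \<Rightarrow> (complex ^ 'n) set set" where
  "proj_subspace W = {proj_point v | v. v \<in> W \<and> v \<noteq> 0}"

definition proj_span :: "(complex ^ 'n) set set \<Rightarrow> (complex ^ 'n) set set" where
  "proj_span Z = \<Inter> {proj_subspace W | W. vec.subspace W \<and> Z \<subseteq> proj_subspace W}"

definition tensor_prod ::
    "complex ^ 'i \<Rightarrow> complex ^ 'j \<Rightarrow> complex ^ 'k \<Rightarrow> ('i::finite, 'j::finite, 'k::finite) tensor" where
  "tensor_prod x y z = vec_lambda (\<lambda>(i, j, k). x $ i * y $ j * z $ k)"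

definition contract1 ::
    "('i::finite, 'j::finite, 'k::finite) tensor \<Rightarrow> complex ^ 'j \<Rightarrow> complex ^ 'k \<Rightarrow> complex ^ 'i" where
  "contract1 T y z = (\<chi> i. \<Sum>j\<in>UNIV. \<Sum>k\<in>UNIV. T $ (i, j, k) * y $ j * z $ k)"

definition contract2 ::
    "('i::finite, 'j::finite, 'k::finite) tensor \<Rightarrow> complex ^ 'i \<Rightarrow> complex ^ 'k \<Rightarrow> complex ^ 'j" where
  "contract2 T x z = (\<chi> j. \<Sum>i\<in>UNIV. \<Sum>k\<in>UNIV. T $ (i, j, k) * x $ i * z $ k)"

definition contract3 ::
    "('i::finite, 'j::finite, 'k::finite) tensor \<Rightarrow> complex ^ 'i \<Rightarrow> complex ^ 'j \<Rightarrow> complex ^ 'k" where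
  "contract3 T x y = (\<chi> k. \<Sum>i\<in>UNIV. \<Sum>j\<in>UNIV. T $ (i, j, k) * x $ i * y $ j)"

text \<open>
  Linear dependence of the pair \<open>(u, v)\<close> as a family: unlike \<open>vec.dependent {u, v}\<close>, this
  also holds when \<open>u = v \<noteq> 0\<close>.
\<close>

definition lin_dep_pair :: "complex ^ 'n \<Rightarrow> complex ^ 'n \<Rightarrow> bool" where
  "lin_dep_pair u v \<longleftrightarrow> (\<exists>\<alpha> \<beta>. (\<alpha> \<noteq> 0 \<or> \<beta> \<noteq> 0) \<and> \<alpha> *s u + \<beta> *s v = 0)"

definition singular_vector_triple ::
    "('i::finite, 'j::finite, 'k::finite) tensor \<Rightarrow>
       complex ^ 'i \<Rightarrow> complex ^ 'j \<Rightarrow> complex ^ 'k \<Rightarrow> bool" where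
  "singular_vector_triple T x y z \<longleftrightarrow>
     x \<noteq> 0 \<and> y \<noteq> 0 \<and> z \<noteq> 0 \<and>
     lin_dep_pair (contract1 T y z) x \<and>
     lin_dep_pair (contract2 T x z) y \<and>
     lin_dep_pair (contract3 T x y) z"

definition singular_points ::
    "('i::finite, 'j::finite, 'k::finite) tensor \<Rightarrow> ('i, 'j, 'k) tensor set set" where
  "singular_points T =
     {proj_point (tensor_prod x y z) | x y z. singular_vector_triple T x y z}"

text \<open>
  The defining equations are antisymmetric in \<open>p, q\<close>, so ranging over all pairs of indices
  gives the same equations as ranging over \<open>p < q\<close>, and no order on the index types is needed.
\<close>

definition critical_space ::
    "('i::finite, 'j::finite, 'k::finite) tensor \<Rightarrow> ('i, 'j, 'k) tensor set" where
  "critical_space T = {z.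
     (\<forall>p q. (\<Sum>j\<in>UNIV. \<Sum>k\<in>UNIV. T $ (p, j, k) * z $ (q, j, k) - T $ (q, j, k) * z $ (p, j, k)) = 0) \<and>
     (\<forall>p q. (\<Sum>i\<in>UNIV. \<Sum>k\<in>UNIV. T $ (i, p, k) * z $ (i, q, k) - T $ (i, q, k) * z $ (i, p, k)) = 0) \<and>
     (\<forall>p q. (\<Sum>i\<in>UNIV. \<Sum>j\<in>UNIV. T $ (i, j, p) * z $ (i, j, q) - T $ (i, j, q) * z $ (i, j, p)) = 0)}"

end

theory Submission imports Defs "HOL-Computational_Algebra.Polynomial" begin

text \<open>
  Regard \<open>T\<close> as a linear map \<open>\<phi>\<close> from \<open>V\<^sub>1 \<otimes> V\<^sub>2\<close> to \<open>V\<^sub>3\<close>. If the kernel of \<open>\<phi>\<close> contains no rank-one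
  tensor, then the third component of a singular triple is a multiple of \<open>\<phi>(x \<otimes> y)\<close>, so every \<open>G\<close>
  for which \<open>\<langle>\<phi>(x \<otimes> y), G(x \<otimes> y)\<rangle>\<close> vanishes identically in \<open>x, y\<close> is a linear equation satisfied
  by \<open>Z\<^sub>T\<close>. This is a biquadratic form, so with \<open>a = 2\<close> such \<open>G\<close> form a space of dimension at least
  \<open>3(b+1)(b+4) - 3(b+1)(b+2) = 6(b+1)\<close>. For \<open>b \<le> 4\<close> this exceeds \<open>(b+4)(b+3)/2\<close>, the number of critical
  equations of the third mode, hence some \<open>G\<close> is not of the form \<open>K \<cdot> \<phi>\<close> with \<open>K\<close> skew. If it were a
  combination of all critical equations, its skew parts acting on \<open>V\<^sub>1\<close> and \<open>V\<^sub>2\<close> would stabilise the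
  form \<open>|\<phi>(x \<otimes> y)|\<^sup>2\<close>, which for general \<open>T\<close> forces them to vanish. So \<open>G\<close> cuts \<open>H\<^sub>T\<close> properly.
\<close>

section \<open>Polynomial functions and the bilinear pairing\<close>

lemma polynomial_fun_uminus: "polynomial_fun f \<Longrightarrow> polynomial_fun (\<lambda>v. - f v)"
  using polynomial_fun.mult[OF polynomial_fun.const[of "-1"], of f] by simp

lemma polynomial_fun_diff:
  "polynomial_fun f \<Longrightarrow> polynomial_fun g \<Longrightarrow> polynomial_fun (\<lambda>v. f v - g v)"
  using polynomial_fun.add[OF _ polynomial_fun_uminus, of f g] by simp

lemma polynomial_fun_sum:
  "(\<And>i. i \<in> I \<Longrightarrow> polynomial_fun (f i)) \<Longrightarrow> polynomial_fun (\<lambda>v. \<Sum>i\<in>I. f i v)"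
  by (induction I rule: infinite_finite_induct)
    (auto intro: polynomial_fun.add polynomial_fun.const)

lemma polynomial_fun_if:
  "polynomial_fun f \<Longrightarrow> polynomial_fun g \<Longrightarrow> polynomial_fun (\<lambda>v. if c then f v else g v)"
  by (cases c) simp_all

lemmas polynomial_fun_intros =
  polynomial_fun.intros polynomial_fun_uminus polynomial_fun_diff polynomial_fun_sum
  polynomial_fun_if

lemma polynomial_fun_on_line:
  assumes "polynomial_fun f"
  obtains p :: "complex poly" where "\<And>t. f (u + t *s d) = poly p t"
proof -
  from assms have "\<exists>p :: complex poly. \<forall>t. f (u + t *s d) = poly p t"
  proof induction
    case (const c)
    show ?case by (rule exI[of _ "[:c:]"]) simp
  next
    case (coord i)
    show ?case by (rule exI[of _ "[:u $ i, d $ i:]"]) simp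
  next
    case (add f g)
    then show ?case by (metis poly_add)
  next
    case (mult f g)
    then show ?case by (metis poly_mult)
  qed
  with that show ?thesis by blast
qed

text \<open>Restricted to the line through \<open>u\<close> and \<open>v\<close>, both functions
  become nonzero univariate polynomials, whose product is again nonzero and so has a non-root. Thus
  two nonempty basic open sets meet.\<close>

lemma polynomial_fun_mult_nonzero:
  assumes "polynomial_fun f" "polynomial_fun g" "f u \<noteq> 0" "g v \<noteq> 0"
  obtains w where "f w * g w \<noteq> 0"
proof -
  obtain p where p: "\<And>t. f (u + t *s (v - u)) = poly p t"
    using polynomial_fun_on_line[OF assms(1)] by blast
  obtain q where q: "\<And>t. g (u + t *s (v - u)) = poly q t"
    using polynomial_fun_on_line[OF assms(2)] by blast
  have "p \<noteq> 0" using p[of 0] assms(3) by auto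
  moreover have "q \<noteq> 0" using q[of 1] assms(4) by auto
  ultimately have "p * q \<noteq> 0" by simp
  then obtain t where "poly (p * q) t \<noteq> 0"
    using poly_all_0_iff_0 by blast
  then show ?thesis
    using that[of "u + t *s (v - u)"] p q by simp
qed

lemma holds_for_generalI:
  assumes "polynomial_fun f" "f u \<noteq> 0" "\<And>v. f v \<noteq> 0 \<Longrightarrow> P v"
  shows "holds_for_general P"
  unfolding holds_for_general_def zariski_open_def zariski_closed_def
proof (intro exI conjI)
  show "\<forall>g\<in>{f}. polynomial_fun g" using assms(1) by simp
  show "- {v. f v \<noteq> 0} = {v. \<forall>g\<in>{f}. g v = 0}" by auto
qed (use assms in auto)

section \<open>Injectivity as an open condition\<close>

text \<open>
  Fraction-free Gaussian elimination with pivots that are nonzero at \<open>u\<close>; \<open>f\<close> is the product of the pivots.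
\<close>

lemma generic_injective:
  fixes A :: "'r \<Rightarrow> 'c \<Rightarrow> complex ^ 'n \<Rightarrow> complex"
  assumes "finite I"
    and "\<And>r i. polynomial_fun (A r i)"
    and "\<And>w i. (\<And>r. (\<Sum>i\<in>I. A r i u * w i) = 0) \<Longrightarrow> i \<in> I \<Longrightarrow> w i = 0"
  shows "\<exists>f. polynomial_fun f \<and> f u \<noteq> 0 \<and>
    (\<forall>v. f v \<noteq> 0 \<longrightarrow> (\<forall>w. (\<forall>r. (\<Sum>i\<in>I. A r i v * w i) = 0) \<longrightarrow> (\<forall>i\<in>I. w i = 0)))"
  using assms
proof (induction I arbitrary: A rule: finite_induct)
  case empty
  show ?case
    by (rule exI[of _ "\<lambda>_. 1"]) (auto intro: polynomial_fun.const)
next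
  case (insert c I)
  note inj = insert.prems(2)
  \<comment> \<open>If column \<open>c\<close> vanished at \<open>u\<close>, the unit vector of
    \<open>c\<close> would lie in the kernel.\<close>
  have "\<exists>r. A r c u \<noteq> 0"
  proof (rule ccontr)
    assume "\<not> ?thesis"
    then have "(\<Sum>i\<in>insert c I. A r i u * (if i = c then 1 else 0)) = 0" for r
      by (intro sum.neutral) auto
    from inj[OF this, of c] show False by simp
  qed
  then obtain r where r: "A r c u \<noteq> 0" by blast
  \<comment> \<open>Cross-multiplication with the pivot row clears column \<open>c\<close> and keeps
    all entries polynomial.\<close>
  define B where "B s j v = A r c v * A s j v - A s c v * A r j v" for s j v
  have elim: "(\<Sum>j\<in>I. B s j v * w j) =
      A r c v * (\<Sum>j\<in>insert c I. A s j v * w j) - A s c v * (\<Sum>j\<in>insert c I. A r j v * w j)"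
    for s v w
    using insert.hyps
    by (simp add: B_def algebra_simps sum_subtractf sum_distrib_left)
  have "\<exists>f. polynomial_fun f \<and> f u \<noteq> 0 \<and>
    (\<forall>v. f v \<noteq> 0 \<longrightarrow> (\<forall>w. (\<forall>r. (\<Sum>i\<in>I. B r i v * w i) = 0) \<longrightarrow> (\<forall>i\<in>I. w i = 0)))"
  proof (rule insert.IH)
    show "polynomial_fun (B s j)" for s j
      unfolding B_def by (intro polynomial_fun_intros insert.prems)
  next
    fix w i
    assume w: "\<And>s. (\<Sum>i\<in>I. B s i u * w i) = 0" and i: "i \<in> I"
    \<comment> \<open>The value at \<open>c\<close> solves the pivot row at \<open>u\<close>, which
      extends a kernel vector of \<open>B\<close> to one of \<open>A\<close>.\<close>
    define w' where "w' = w(c := - (\<Sum>j\<in>I. A r j u * w j) / A r c u)"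
    have eq: "(\<Sum>j\<in>I. C j * w' j) = (\<Sum>j\<in>I. C j * w j)" for C
      using insert.hyps by (intro sum.cong) (auto simp: w'_def)
    have r0: "(\<Sum>j\<in>insert c I. A r j u * w' j) = 0"
      using insert.hyps r by (simp add: eq) (simp add: w'_def)
    have "(\<Sum>j\<in>insert c I. A s j u * w' j) = 0" for s
      using elim[of s u w'] r0 r w[of s] by (simp add: eq)
    from inj[OF this, of i] i insert.hyps show "w i = 0"
      by (auto simp: w'_def split: if_splits)
  qed
  then obtain f where f: "polynomial_fun f" "f u \<noteq> 0"
    and finj: "\<And>v w i. f v \<noteq> 0 \<Longrightarrow> (\<And>r. (\<Sum>i\<in>I. B r i v * w i) = 0) \<Longrightarrow> i \<in> I \<Longrightarrow> w i = 0"
    by blast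
  show ?case
  proof (intro exI conjI allI impI)
    show "polynomial_fun (\<lambda>v. A r c v * f v)"
      by (intro polynomial_fun_intros insert.prems f)
    show "A r c u * f u \<noteq> 0" using r f by simp
  next
    fix v w
    assume v: "A r c v * f v \<noteq> 0" and w: "\<forall>r. (\<Sum>i\<in>insert c I. A r i v * w i) = 0"
    have w0: "w i = 0" if "i \<in> I" for i
      using finj[of v w, OF _ _ that] v w by (simp add: elim)
    with w[rule_format, of r] insert.hyps v have "w c = 0" by simp
    with w0 show "\<forall>i\<in>insert c I. w i = 0" by simp
  qed
qed

section \<open>The complex bilinear pairing (no conjugation), annihilators and separation\<close>

definition pairing :: "complex ^ 'n \<Rightarrow> complex ^ 'n \<Rightarrow> complex" where
  "pairing u v = (\<Sum>i\<in>UNIV. u $ i * v $ i)"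

lemma pairing_add_right: "pairing u (v + w) = pairing u v + pairing u w"
  by (simp add: pairing_def algebra_simps sum.distrib)

lemma pairing_add_left: "pairing (u + v) w = pairing u w + pairing v w"
  by (simp add: pairing_def algebra_simps sum.distrib)

lemma pairing_diff_right: "pairing u (v - w) = pairing u v - pairing u w"
  by (simp add: pairing_def algebra_simps sum_subtractf)

lemma pairing_scale_right: "pairing u (c *s v) = c * pairing u v"
  by (simp add: pairing_def algebra_simps sum_distrib_left)

lemma pairing_zero_right [simp]: "pairing u 0 = 0"
  by (simp add: pairing_def)

lemma subspace_annihilator: "vec.subspace {v. \<forall>c\<in>C. pairing c v = 0}"
  by (rule vec.subspaceI) (auto simp: pairing_add_right pairing_scale_right)

text \<open>Each new equation lowers the dimension by at most one: an old solution \<open>u\<close>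
  violating it spans, together with the new solutions, all old solutions.\<close>

lemma dim_annihilator_ge:
  fixes C :: "(complex ^ 'n) set"
  assumes "finite C"
  shows "CARD('n) \<le> vec.dim {v. \<forall>c\<in>C. pairing c v = 0} + card C"
  using assms
proof (induction C rule: finite_induct)
  case empty
  show ?case by (simp add: card_cart_basis)
next
  case (insert c C)
  let ?S = "{v. \<forall>c\<in>C. pairing c v = 0}" and ?S' = "{v. \<forall>c\<in>insert c C. pairing c v = 0}"
  have "vec.dim ?S \<le> vec.dim ?S' + 1"
  proof (cases "\<exists>u\<in>?S. pairing c u \<noteq> 0")
    case True
    then obtain u where u: "u \<in> ?S" "pairing c u \<noteq> 0" by blast
    have "?S \<subseteq> vec.span (insert u ?S')"
    proof
      fix v assume v: "v \<in> ?S"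
      let ?a = "pairing c v / pairing c u"
      have "v - ?a *s u \<in> ?S'"
        using u v by (auto simp: pairing_diff_right pairing_scale_right)
      then have "(v - ?a *s u) + ?a *s u \<in> vec.span (insert u ?S')"
        by (intro vec.span_add vec.span_scale vec.span_base) auto
      then show "v \<in> vec.span (insert u ?S')" by simp
    qed
    then have "vec.dim ?S \<le> vec.dim (insert u ?S')"
      using vec.dim_subset[of ?S "vec.span (insert u ?S')"] by (simp only: vec.dim_span)
    then show ?thesis
      using vec.dim_insert[of u ?S'] by (simp only: split: if_splits)
  next
    case False
    then have "?S' = ?S" by auto
    then show ?thesis by simp
  qed
  then show ?case using insert by simp
qed

text \<open>A basis of \<open>E\<close> stays independent after adding \<open>g\<close>, so some
  linear map kills the basis but not \<open>g\<close>. One coordinate of that map is a functional,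
  and the pairing represents it by a vector.\<close>

lemma separating_pairing:
  fixes E :: "(complex ^ 'n) set"
  assumes "vec.subspace E" "g \<notin> E"
  obtains z where "\<And>e. e \<in> E \<Longrightarrow> pairing e z = 0" "pairing g z \<noteq> 0"
proof -
  obtain B where B: "B \<subseteq> E" "vec.independent B" "E \<subseteq> vec.span B"
    using vec.maximal_independent_subset by blast
  have spanB: "vec.span B = E"
    using B assms(1) by (metis vec.span_minimal subset_antisym)
  then have ind: "vec.independent (insert g B)"
    using B assms(2) by (simp add: vec.independent_insert vec.span_base)
  obtain n0 :: 'n where True by blast
  obtain f :: "complex ^ 'n \<Rightarrow> complex ^ 'n"
    where f: "Vector_Spaces.linear (*s) (*s) f"
      and fB: "\<forall>x\<in>insert g B. f x = (if x = g then axis n0 1 else 0)"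
    using vec.linear_independent_extend[OF ind, of "\<lambda>x. if x = g then axis n0 1 else 0"] by blast
  interpret f: Vector_Spaces.linear "(*s)" "(*s)" f by (fact f)
  define z where "z = (\<chi> i. f (axis i 1) $ n0)"
  have fz: "f v $ n0 = pairing v z" for v
  proof -
    have "f v = f (\<Sum>i\<in>UNIV. v $ i *s axis i 1)" by (simp add: basis_expansion)
    also have "\<dots> $ n0 = pairing v z"
      by (simp add: f.sum f.scale pairing_def z_def)
    finally show ?thesis .
  qed
  have "g \<notin> B" using B assms(2) by blast
  have "f e = 0" if "e \<in> E" for e
    by (rule f.eq_0_on_span[of B]) (use fB \<open>g \<notin> B\<close> that spanB in auto)
  then have "pairing e z = 0" if "e \<in> E" for e
    using that fz[of e] by simp
  moreover have "pairing g z \<noteq> 0"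
    using fz[of g] fB by (simp add: axis_def)
  ultimately show ?thesis using that by blast
qed

section \<open>Critical equations\<close>

lemma sum_UNIV_triple:
  fixes f :: "'i::finite \<times> 'j::finite \<times> 'k::finite \<Rightarrow> 'a::comm_monoid_add"
  shows "(\<Sum>t\<in>UNIV. f t) = (\<Sum>i\<in>UNIV. \<Sum>j\<in>UNIV. \<Sum>k\<in>UNIV. f (i, j, k))"
proof -
  have "(\<Sum>t\<in>UNIV. f t) = (\<Sum>t\<in>UNIV \<times> UNIV \<times> UNIV. f t)" by simp
  also have "\<dots> = (\<Sum>i\<in>UNIV. \<Sum>s\<in>UNIV \<times> UNIV. f (i, s))"
    by (simp only: sum.cartesian_product) (simp add: split_def)
  also have "\<dots> = (\<Sum>i\<in>UNIV. \<Sum>j\<in>UNIV. \<Sum>k\<in>UNIV. f (i, j, k))"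
    by (simp only: sum.cartesian_product) (simp add: split_def)
  finally show ?thesis .
qed

section \<open>Skew matrices acting on the modes of a tensor\<close>

definition skew :: "('a \<Rightarrow> 'a \<Rightarrow> complex) \<Rightarrow> bool" where
  "skew m \<longleftrightarrow> (\<forall>p q. m p q = - m q p)"

text \<open>The elementary skew matrix E_qp - E_pq, signed so that pairing with its action on
  \<open>T\<close> gives exactly the critical equation of \<open>p\<close> and
  \<open>q\<close>.\<close>

definition skew_unit :: "'a \<Rightarrow> 'a \<Rightarrow> 'a \<Rightarrow> 'a \<Rightarrow> complex" where
  "skew_unit p q i s = of_bool (i = q \<and> s = p) - of_bool (i = p \<and> s = q)"

lemma skew_skew_unit [simp]: "skew (skew_unit p q)"
  unfolding skew_def skew_unit_def by (simp add: conj_commute)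

lemma sum_skew_unit:
  fixes F :: "'a::finite \<Rightarrow> 'a \<Rightarrow> complex"
  shows "(\<Sum>i\<in>UNIV. \<Sum>s\<in>UNIV. skew_unit p q i s * F i s) = F q p - F p q"
proof -
  have "skew_unit p q i s * F i s =
      of_bool (i = q) * (of_bool (s = p) * F i s) - of_bool (i = p) * (of_bool (s = q) * F i s)"
    for i s by (auto simp: skew_unit_def)
  then show ?thesis
    by (simp only: sum_subtractf sum_distrib_left[symmetric])
      (simp add: of_bool_def if_distribR if_distrib[where f = "\<lambda>c. c * _"] cong: if_cong)
qed

lemma skew_diag:
  assumes "skew m"
  shows "m p p = 0"
proof -
  have "m p p = - m p p" using assms unfolding skew_def by blast
  then show ?thesis by simp
qed

text \<open>Exchanging the two summation indices turns the double sum into its own negative.\<close>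

lemma skew_quadratic_form:
  fixes c :: "'a::finite \<Rightarrow> complex"
  assumes "skew m"
  shows "(\<Sum>p\<in>UNIV. c p * (\<Sum>q\<in>UNIV. m p q * c q)) = 0"
proof -
  let ?S = "\<Sum>p\<in>UNIV. \<Sum>q\<in>UNIV. c p * m p q * c q"
  have "?S = (\<Sum>q\<in>UNIV. \<Sum>p\<in>UNIV. c p * m p q * c q)"
    by (rule sum.swap)
  also have "\<dots> = (\<Sum>q\<in>UNIV. \<Sum>p\<in>UNIV. - (c q * m q p * c p))"
  proof (intro sum.cong refl)
    fix p q
    have "m p q = - m q p" using assms unfolding skew_def by blast
    then show "c p * m p q * c q = - (c q * m q p * c p)" by simp
  qed
  also have "\<dots> = - ?S" by (simp add: sum_negf)
  finally have "?S = 0" by simp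
  then show ?thesis by (simp add: sum_distrib_left mult.assoc)
qed

text \<open>For skew \<open>m\<close> this is the infinitesimal action of the orthogonal group of
  the first factor; \<open>act2\<close> and \<open>act3\<close> do the same for the other
  factors.\<close>

definition act1 ::
  "('i \<Rightarrow> 'i \<Rightarrow> complex) \<Rightarrow> ('i::finite, 'j::finite, 'k::finite) tensor \<Rightarrow> ('i, 'j, 'k) tensor" where
  "act1 m T = vec_lambda (\<lambda>(i, j, k). \<Sum>s\<in>UNIV. m i s * T $ (s, j, k))"

definition act2 ::
  "('j \<Rightarrow> 'j \<Rightarrow> complex) \<Rightarrow> ('i::finite, 'j::finite, 'k::finite) tensor \<Rightarrow> ('i, 'j, 'k) tensor" where
  "act2 m T = vec_lambda (\<lambda>(i, j, k). \<Sum>s\<in>UNIV. m j s * T $ (i, s, k))"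

definition act3 ::
  "('k \<Rightarrow> 'k \<Rightarrow> complex) \<Rightarrow> ('i::finite, 'j::finite, 'k::finite) tensor \<Rightarrow> ('i, 'j, 'k) tensor" where
  "act3 m T = vec_lambda (\<lambda>(i, j, k). \<Sum>s\<in>UNIV. m k s * T $ (i, j, s))"

lemma act_nth [simp]:
  "act1 m T $ (i, j, k) = (\<Sum>s\<in>UNIV. m i s * T $ (s, j, k))"
  "act2 n T $ (i, j, k) = (\<Sum>s\<in>UNIV. n j s * T $ (i, s, k))"
  "act3 r T $ (i, j, k) = (\<Sum>s\<in>UNIV. r k s * T $ (i, j, s))"
  by (simp_all add: act1_def act2_def act3_def)

text \<open>With \<open>m\<close> pulled to the front, inserting a \<open>skew_unit\<close> for
  \<open>m\<close> isolates a single critical equation of the first mode.\<close>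

lemma pairing_act1:
  "pairing (act1 m T) z = (\<Sum>i\<in>UNIV. \<Sum>s\<in>UNIV. m i s * (\<Sum>j\<in>UNIV. \<Sum>k\<in>UNIV. T $ (s, j, k) * z $ (i, j, k)))"
proof -
  have "pairing (act1 m T) z =
      (\<Sum>i\<in>UNIV. \<Sum>j\<in>UNIV. \<Sum>k\<in>UNIV. \<Sum>s\<in>UNIV. m i s * (T $ (s, j, k) * z $ (i, j, k)))"
    by (simp add: pairing_def sum_UNIV_triple sum_distrib_right mult.assoc)
  also have "\<dots> = (\<Sum>i\<in>UNIV. \<Sum>j\<in>UNIV. \<Sum>s\<in>UNIV. \<Sum>k\<in>UNIV. m i s * (T $ (s, j, k) * z $ (i, j, k)))"
    by (intro sum.cong refl sum.swap)
  also have "\<dots> = (\<Sum>i\<in>UNIV. \<Sum>s\<in>UNIV. \<Sum>j\<in>UNIV. \<Sum>k\<in>UNIV. m i s * (T $ (s, j, k) * z $ (i, j, k)))"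
    by (intro sum.cong refl sum.swap)
  finally show ?thesis by (simp add: sum_distrib_left)
qed

lemma pairing_act2:
  "pairing (act2 m T) z = (\<Sum>j\<in>UNIV. \<Sum>s\<in>UNIV. m j s * (\<Sum>i\<in>UNIV. \<Sum>k\<in>UNIV. T $ (i, s, k) * z $ (i, j, k)))"
proof -
  have "pairing (act2 m T) z =
      (\<Sum>i\<in>UNIV. \<Sum>j\<in>UNIV. \<Sum>k\<in>UNIV. \<Sum>s\<in>UNIV. m j s * (T $ (i, s, k) * z $ (i, j, k)))"
    by (simp add: pairing_def sum_UNIV_triple sum_distrib_right mult.assoc)
  also have "\<dots> = (\<Sum>j\<in>UNIV. \<Sum>i\<in>UNIV. \<Sum>k\<in>UNIV. \<Sum>s\<in>UNIV. m j s * (T $ (i, s, k) * z $ (i, j, k)))"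
    by (rule sum.swap)
  also have "\<dots> = (\<Sum>j\<in>UNIV. \<Sum>i\<in>UNIV. \<Sum>s\<in>UNIV. \<Sum>k\<in>UNIV. m j s * (T $ (i, s, k) * z $ (i, j, k)))"
    by (intro sum.cong refl sum.swap)
  also have "\<dots> = (\<Sum>j\<in>UNIV. \<Sum>s\<in>UNIV. \<Sum>i\<in>UNIV. \<Sum>k\<in>UNIV. m j s * (T $ (i, s, k) * z $ (i, j, k)))"
    by (intro sum.cong refl sum.swap)
  finally show ?thesis by (simp add: sum_distrib_left)
qed

lemma pairing_act3:
  "pairing (act3 m T) z = (\<Sum>k\<in>UNIV. \<Sum>s\<in>UNIV. m k s * (\<Sum>i\<in>UNIV. \<Sum>j\<in>UNIV. T $ (i, j, s) * z $ (i, j, k)))"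
proof -
  have "pairing (act3 m T) z =
      (\<Sum>i\<in>UNIV. \<Sum>j\<in>UNIV. \<Sum>k\<in>UNIV. \<Sum>s\<in>UNIV. m k s * (T $ (i, j, s) * z $ (i, j, k)))"
    by (simp add: pairing_def sum_UNIV_triple sum_distrib_right mult.assoc)
  also have "\<dots> = (\<Sum>i\<in>UNIV. \<Sum>k\<in>UNIV. \<Sum>j\<in>UNIV. \<Sum>s\<in>UNIV. m k s * (T $ (i, j, s) * z $ (i, j, k)))"
    by (intro sum.cong refl sum.swap)
  also have "\<dots> = (\<Sum>k\<in>UNIV. \<Sum>i\<in>UNIV. \<Sum>j\<in>UNIV. \<Sum>s\<in>UNIV. m k s * (T $ (i, j, s) * z $ (i, j, k)))"
    by (rule sum.swap)
  also have "\<dots> = (\<Sum>k\<in>UNIV. \<Sum>i\<in>UNIV. \<Sum>s\<in>UNIV. \<Sum>j\<in>UNIV. m k s * (T $ (i, j, s) * z $ (i, j, k)))"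
    by (intro sum.cong refl sum.swap)
  also have "\<dots> = (\<Sum>k\<in>UNIV. \<Sum>s\<in>UNIV. \<Sum>i\<in>UNIV. \<Sum>j\<in>UNIV. m k s * (T $ (i, j, s) * z $ (i, j, k)))"
    by (intro sum.cong refl sum.swap)
  finally show ?thesis by (simp add: sum_distrib_left)
qed

text \<open>The tangent space at \<open>T\<close> to its orbit under the product of the three
  orthogonal groups.\<close>

definition critical_equations ::
  "('i::finite, 'j::finite, 'k::finite) tensor \<Rightarrow> ('i, 'j, 'k) tensor set" where
  "critical_equations T =
     {act1 m T + act2 n T + act3 r T | m n r. skew m \<and> skew n \<and> skew r}"

lemma critical_equations_memI:
  "skew m \<Longrightarrow> act1 m T \<in> critical_equations T"
  "skew n \<Longrightarrow> act2 n T \<in> critical_equations T"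
  "skew r \<Longrightarrow> act3 r T \<in> critical_equations T"
proof -
  have z: "act1 (\<lambda>_ _. 0) T = 0" "act2 (\<lambda>_ _. 0) T = 0" "act3 (\<lambda>_ _. 0) T = 0"
    by (simp_all add: vec_eq_iff)
  have z': "skew (\<lambda>_ _. 0)" by (simp add: skew_def)
  have *: "act1 m T + act2 n T + act3 r T \<in> critical_equations T" if "skew m" "skew n" "skew r" for m n r
    using that unfolding critical_equations_def by blast
  show "skew m \<Longrightarrow> act1 m T \<in> critical_equations T"
    using *[OF _ z' z'] z by simp
  show "skew n \<Longrightarrow> act2 n T \<in> critical_equations T"
    using *[OF z' _ z'] z by simp
  show "skew r \<Longrightarrow> act3 r T \<in> critical_equations T"
    using *[OF z' z'] z by simp
qed

lemma subspace_critical_equations: "vec.subspace (critical_equations T)"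
proof (rule vec.subspaceI)
  have "act1 (\<lambda>_ _. 0) T = 0" "skew (\<lambda>_ _. 0)"
    by (simp_all add: vec_eq_iff skew_def)
  then show "0 \<in> critical_equations T" by (metis critical_equations_memI(1))
next
  fix e e' assume "e \<in> critical_equations T" "e' \<in> critical_equations T"
  then obtain m n r m' n' r' where
    e: "e = act1 m T + act2 n T + act3 r T" "e' = act1 m' T + act2 n' T + act3 r' T"
    and sk: "skew m" "skew n" "skew r" "skew m'" "skew n'" "skew r'"
    unfolding critical_equations_def by blast
  have "e + e' = act1 (\<lambda>p q. m p q + m' p q) T + act2 (\<lambda>p q. n p q + n' p q) T
      + act3 (\<lambda>p q. r p q + r' p q) T"
    by (simp add: e vec_eq_iff distrib_right sum.distrib)
  moreover have "skew (\<lambda>p q. m p q + m' p q)" "skew (\<lambda>p q. n p q + n' p q)"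
    "skew (\<lambda>p q. r p q + r' p q)"
    using sk unfolding skew_def by (metis minus_add_distrib)+
  ultimately show "e + e' \<in> critical_equations T"
    unfolding critical_equations_def by blast
next
  fix c e assume "e \<in> critical_equations T"
  then obtain m n r where e: "e = act1 m T + act2 n T + act3 r T"
    and sk: "skew m" "skew n" "skew r"
    unfolding critical_equations_def by blast
  have "c *s e = act1 (\<lambda>p q. c * m p q) T + act2 (\<lambda>p q. c * n p q) T
      + act3 (\<lambda>p q. c * r p q) T"
    by (simp add: e vec_eq_iff distrib_left sum_distrib_left mult.assoc)
  moreover have "skew (\<lambda>p q. c * m p q)" "skew (\<lambda>p q. c * n p q)" "skew (\<lambda>p q. c * r p q)"
    using sk unfolding skew_def by (metis mult_minus_right)+
  ultimately show "c *s e \<in> critical_equations T"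
    unfolding critical_equations_def by blast
qed

lemma critical_spaceI:
  assumes "\<And>e. e \<in> critical_equations T \<Longrightarrow> pairing e z = 0"
  shows "z \<in> critical_space T"
proof -
  have "pairing (act1 (skew_unit p q) T) z = 0" "pairing (act2 (skew_unit p' q') T) z = 0"
    "pairing (act3 (skew_unit p'' q'') T) z = 0" for p q p' q' p'' q''
    by (auto intro!: assms critical_equations_memI)
  then show ?thesis
    unfolding critical_space_def pairing_act1 pairing_act2 pairing_act3 sum_skew_unit
    by (simp add: sum_subtractf)
qed

text \<open>Multiplied by either coefficient of the linear relation, the 2x2 minor vanishes, and one
  of the coefficients is nonzero.\<close>

lemma lin_dep_pair_minors:
  assumes "lin_dep_pair u v"
  shows "u $ p * v $ q = u $ q * v $ p"
proof -
  obtain \<alpha> \<beta> where ab: "\<alpha> \<noteq> 0 \<or> \<beta> \<noteq> 0" "\<alpha> *s u + \<beta> *s v = 0"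
    using assms unfolding lin_dep_pair_def by blast
  have e: "\<alpha> * u $ s = - (\<beta> * v $ s)" for s
    using arg_cong[OF ab(2), of "\<lambda>x. x $ s"] by (simp add: add_eq_0_iff2)
  have "\<alpha> * (u $ p * v $ q) = \<alpha> * (u $ q * v $ p)"
    using e[of p] e[of q] by algebra
  moreover have "\<beta> * (u $ p * v $ q) = \<beta> * (u $ q * v $ p)"
    using e[of p] e[of q] by algebra
  ultimately show ?thesis using ab(1) by (metis mult_cancel_left)
qed

lemma tensor_prod_nth [simp]: "tensor_prod x y z $ (i, j, k) = x $ i * y $ j * z $ k"
  by (simp add: tensor_prod_def)

text \<open>On a rank-one tensor each critical equation reduces to a 2x2 minor of a contraction of
  \<open>T\<close> against the matching component.\<close>

lemma tensor_prod_critical: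
  assumes "singular_vector_triple T x y z"
  shows "tensor_prod x y z \<in> critical_space T"
proof -
  have c1: "(\<Sum>j\<in>UNIV. \<Sum>k\<in>UNIV. T $ (p, j, k) * (x $ q * y $ j * z $ k)) = contract1 T y z $ p * x $ q" for p q
    by (simp add: contract1_def sum_distrib_right sum_distrib_left mult_ac)
  have c2: "(\<Sum>i\<in>UNIV. \<Sum>k\<in>UNIV. T $ (i, p, k) * (x $ i * y $ q * z $ k)) = contract2 T x z $ p * y $ q" for p q
    by (simp add: contract2_def sum_distrib_right sum_distrib_left mult_ac)
  have c3: "(\<Sum>i\<in>UNIV. \<Sum>j\<in>UNIV. T $ (i, j, p) * (x $ i * y $ j * z $ q)) = contract3 T x y $ p * z $ q" for p q
    by (simp add: contract3_def sum_distrib_right sum_distrib_left mult_ac)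
  show ?thesis
    using assms unfolding singular_vector_triple_def critical_space_def
    by (simp add: sum_subtractf c1 c2 c3 lin_dep_pair_minors)
qed

lemma subspace_critical_space: "vec.subspace (critical_space T)"
proof (rule vec.subspaceI)
  show "0 \<in> critical_space T" by (simp add: critical_space_def)
next
  fix u v assume "u \<in> critical_space T" "v \<in> critical_space T"
  then show "u + v \<in> critical_space T"
    by (simp add: critical_space_def sum_subtractf sum.distrib distrib_left)
next
  fix c u assume "u \<in> critical_space T"
  moreover have "a * (c * v) - b * (c * w) = c * (a * v - b * w)" for a b v w :: complex
    by (simp add: algebra_simps)
  ultimately show "c *s u \<in> critical_space T"
    by (simp add: critical_space_def sum_distrib_left[symmetric])
qed

lemma contract3_add: "contract3 (S + T) x y = contract3 S x y + contract3 T x y"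
  by (simp add: contract3_def vec_eq_iff distrib_right sum.distrib)

lemma contract3_act3: "contract3 (act3 r T) x y $ k = (\<Sum>s\<in>UNIV. r k s * contract3 T x y $ s)"
proof -
  have "contract3 (act3 r T) x y $ k =
      (\<Sum>i\<in>UNIV. \<Sum>j\<in>UNIV. \<Sum>s\<in>UNIV. r k s * (T $ (i, j, s) * x $ i * y $ j))"
    by (simp add: contract3_def sum_distrib_right mult.assoc)
  also have "\<dots> = (\<Sum>i\<in>UNIV. \<Sum>s\<in>UNIV. \<Sum>j\<in>UNIV. r k s * (T $ (i, j, s) * x $ i * y $ j))"
    by (intro sum.cong refl sum.swap)
  also have "\<dots> = (\<Sum>s\<in>UNIV. \<Sum>i\<in>UNIV. \<Sum>j\<in>UNIV. r k s * (T $ (i, j, s) * x $ i * y $ j))"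
    by (rule sum.swap)
  finally show ?thesis by (simp add: contract3_def sum_distrib_left)
qed

section \<open>The extra equations\<close>

text \<open>The injection \<open>e\<close> serves as a linear order on the index type. Swapping
  matches the increasing pairs with the decreasing ones, and the diagonal remains.\<close>

lemma card_less_pairs:
  fixes e :: "'a::finite \<Rightarrow> nat"
  assumes "inj e"
  shows "2 * card {(p, q). e p < e q} + CARD('a) = CARD('a) * CARD('a)"
proof -
  let ?L = "{(p, q). e p < e q}" and ?G = "{(p, q). e q < e p}" and ?D = "range (\<lambda>p :: 'a. (p, p))"
  have "bij_betw prod.swap ?L ?G"
    by (rule bij_betwI[where g = prod.swap]) auto
  then have "card ?G = card ?L" by (simp add: bij_betw_same_card)
  moreover have "card ?D = CARD('a)"
    by (intro card_image) (auto simp: inj_on_def)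
  moreover have "?L \<union> ?G \<union> ?D = UNIV"
    using assms by (fastforce simp: inj_def dest: linorder_neqE_nat)
  then have "card (?L \<union> ?G \<union> ?D) = CARD('a \<times> 'a)" by (rule arg_cong)
  moreover have "card (?L \<union> ?G \<union> ?D) = card ?L + card ?G + card ?D"
    by (subst card_Un_disjoint | force)+
  moreover have "CARD('a \<times> 'a) = CARD('a) * CARD('a)" by simp
  ultimately show ?thesis by linarith
qed

lemma card_le_pairs:
  fixes e :: "'a::finite \<Rightarrow> nat"
  assumes "inj e"
  shows "2 * card {(p, q). e p \<le> e q} = CARD('a) * CARD('a) + CARD('a)"
proof -
  have "{(p, q). e p \<le> e q} = UNIV - prod.swap ` {(p, q). e p < e q}"
    by force
  then have "card {(p, q). e p \<le> e q} = CARD('a \<times> 'a) - card {(p, q). e p < e q}"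
    by (simp add: card_Diff_subset card_image)
  then show ?thesis using card_less_pairs[OF assms] by simp
qed

lemma ex_inj_nat: "\<exists>e :: 'a::finite \<Rightarrow> nat. inj e"
  using ex_bij_betw_finite_nat[of "UNIV :: 'a set"] by (auto simp: bij_betw_def)

text \<open>The fibre of \<open>T\<close> over \<open>(i, j)\<close> moved to position
  \<open>(i', j')\<close>: the coefficient tensor of one summand of the biquadratic form, seen as a
  linear form in \<open>G\<close>.\<close>

definition placed_fibre ::
  "('i::finite, 'j::finite, 'k::finite) tensor \<Rightarrow> 'i \<Rightarrow> 'j \<Rightarrow> 'i \<Rightarrow> 'j \<Rightarrow> ('i, 'j, 'k) tensor" where
  "placed_fibre T i j i' j' = vec_lambda (\<lambda>(s, t, k). if s = i' \<and> t = j' then T $ (i, j, k) else 0)"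

lemma pairing_placed_fibre:
  "pairing (placed_fibre T i j i' j') G = (\<Sum>k\<in>UNIV. T $ (i, j, k) * G $ (i', j', k))"
proof -
  have "pairing (placed_fibre T i j i' j') G = (\<Sum>s\<in>UNIV. \<Sum>t\<in>UNIV.
      if s = i' then if t = j' then (\<Sum>k\<in>UNIV. T $ (i, j, k) * G $ (i', j', k)) else 0 else 0)"
    unfolding pairing_def sum_UNIV_triple placed_fibre_def
    by (intro sum.cong refl) auto
  also have "\<dots> = (\<Sum>s\<in>UNIV. if s = i' then \<Sum>t\<in>UNIV.
      if t = j' then (\<Sum>k\<in>UNIV. T $ (i, j, k) * G $ (i', j', k)) else 0 else 0)"
    by (intro sum.cong refl) simp
  finally show ?thesis by simp
qed

text \<open>Up to a nonzero factor when indices coincide, pairing with it gives the coefficient of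
  \<open>x_i x_i' y_j y_j'\<close> in \<open>contraction_form T G\<close>.\<close>

definition polar_equation ::
  "('i::finite, 'j::finite, 'k::finite) tensor \<Rightarrow> 'i \<Rightarrow> 'i \<Rightarrow> 'j \<Rightarrow> 'j \<Rightarrow> ('i, 'j, 'k) tensor" where
  "polar_equation T i i' j j' =
     placed_fibre T i j i' j' + placed_fibre T i' j i j' +
     placed_fibre T i j' i' j + placed_fibre T i' j' i j"

lemma polar_equation_commute:
  "polar_equation T i' i j j' = polar_equation T i i' j j'"
  "polar_equation T i i' j' j = polar_equation T i i' j j'"
  by (simp_all add: polar_equation_def ac_simps)

definition contraction_form ::
  "('i::finite, 'j::finite, 'k::finite) tensor \<Rightarrow> ('i, 'j, 'k) tensor \<Rightarrow>
     complex ^ 'i \<Rightarrow> complex ^ 'j \<Rightarrow> complex" where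
  "contraction_form T G x y = (\<Sum>k\<in>UNIV. contract3 T x y $ k * contract3 G x y $ k)"

lemma contraction_form_expand:
  "contraction_form T G x y = (\<Sum>i\<in>UNIV. \<Sum>i'\<in>UNIV. \<Sum>j\<in>UNIV. \<Sum>j'\<in>UNIV.
     x $ i * x $ i' * y $ j * y $ j' * pairing (placed_fibre T i j i' j') G)"
proof -
  let ?f = "\<lambda>k i j i' j'. x $ i * x $ i' * y $ j * y $ j' * (T $ (i, j, k) * G $ (i', j', k))"
  have "contraction_form T G x y =
      (\<Sum>k\<in>UNIV. \<Sum>i\<in>UNIV. \<Sum>j\<in>UNIV. \<Sum>i'\<in>UNIV. \<Sum>j'\<in>UNIV. ?f k i j i' j')"
    by (simp only: contraction_form_def contract3_def vec_lambda_beta sum_distrib_right)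
      (simp only: sum_distrib_left mult_ac)
  also have "\<dots> = (\<Sum>i\<in>UNIV. \<Sum>k\<in>UNIV. \<Sum>j\<in>UNIV. \<Sum>i'\<in>UNIV. \<Sum>j'\<in>UNIV. ?f k i j i' j')"
    by (rule sum.swap)
  also have "\<dots> = (\<Sum>i\<in>UNIV. \<Sum>k\<in>UNIV. \<Sum>i'\<in>UNIV. \<Sum>j\<in>UNIV. \<Sum>j'\<in>UNIV. ?f k i j i' j')"
    by (intro sum.cong refl sum.swap)
  also have "\<dots> = (\<Sum>i\<in>UNIV. \<Sum>i'\<in>UNIV. \<Sum>k\<in>UNIV. \<Sum>j\<in>UNIV. \<Sum>j'\<in>UNIV. ?f k i j i' j')"
    by (intro sum.cong refl sum.swap)
  also have "\<dots> = (\<Sum>i\<in>UNIV. \<Sum>i'\<in>UNIV. \<Sum>j\<in>UNIV. \<Sum>k\<in>UNIV. \<Sum>j'\<in>UNIV. ?f k i j i' j')"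
    by (intro sum.cong refl sum.swap)
  also have "\<dots> = (\<Sum>i\<in>UNIV. \<Sum>i'\<in>UNIV. \<Sum>j\<in>UNIV. \<Sum>j'\<in>UNIV. \<Sum>k\<in>UNIV. ?f k i j i' j')"
    by (intro sum.cong refl sum.swap)
  finally show ?thesis by (simp add: pairing_placed_fibre sum_distrib_left)
qed

text \<open>Summed against the monomials, the four terms of \<open>polar_equation\<close> contribute
  equally, so the sum of the vanishing polar equations is four times the form.\<close>

lemma contraction_form_eq_0:
  assumes "\<And>i i' j j'. pairing (polar_equation T i i' j j') G = 0"
  shows "contraction_form T G x y = 0"
proof -
  let ?X = "\<lambda>i i' j j'. x $ i * x $ i' * y $ j * y $ j'"
  let ?a = "\<lambda>i i' j j'. pairing (placed_fibre T i j i' j') G"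
  let ?S = "\<lambda>f :: 'a \<Rightarrow> 'a \<Rightarrow> 'b \<Rightarrow> 'b \<Rightarrow> complex.
    \<Sum>i\<in>UNIV. \<Sum>i'\<in>UNIV. \<Sum>j\<in>UNIV. \<Sum>j'\<in>UNIV. f i i' j j'"
  have swap1: "?S (\<lambda>i i' j j'. f i' i j j') = ?S f" for f
    by (rule sum.swap)
  have swap2: "?S (\<lambda>i i' j j'. f i i' j' j) = ?S f" for f
    by (intro sum.cong refl sum.swap)
  let ?q = "\<lambda>i i' j j'. ?X i i' j j' * ?a i i' j j'"
  have "0 = ?S (\<lambda>i i' j j'. ?X i i' j j' * pairing (polar_equation T i i' j j') G)"
    by (simp add: assms)
  also have "\<dots> = ?S ?q + ?S (\<lambda>i i' j j'. ?q i' i j j') + ?S (\<lambda>i i' j j'. ?q i i' j' j)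
      + ?S (\<lambda>i i' j j'. ?q i' i j' j)"
    by (simp add: polar_equation_def pairing_add_left distrib_left sum.distrib mult_ac)
  also have "?S (\<lambda>i i' j j'. ?q i' i j j') = ?S ?q"
    by (rule swap1)
  also have "?S (\<lambda>i i' j j'. ?q i i' j' j) = ?S ?q"
    by (rule swap2)
  also have "?S (\<lambda>i i' j j'. ?q i' i j' j) = ?S (\<lambda>i i' j j'. ?q i' i j j')"
    by (rule swap2)
  also have "?S (\<lambda>i i' j j'. ?q i' i j j') = ?S ?q"
    by (rule swap1)
  finally have "?S ?q = 0" by simp
  then show ?thesis unfolding contraction_form_expand .
qed

text \<open>The elementary skew matrices of increasing pairs form a basis of the skew matrices; the
  coefficient at \<open>(p, q)\<close> is \<open>r q p\<close>.\<close>

lemma act3_skew_in_span: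
  fixes e :: "'k::finite \<Rightarrow> nat"
  assumes "inj e" "skew r"
  shows "act3 r T \<in> vec.span ((\<lambda>(p, q). act3 (skew_unit p q) T) ` {(p, q). e p < e q})"
proof -
  let ?L = "{(p, q). e p < e q}"
  have r: "r i s = (\<Sum>(p, q)\<in>?L. r q p * skew_unit p q i s)" for i s
  proof -
    have pt: "(case t of (p, q) \<Rightarrow> r q p * skew_unit p q i s) =
        (if t = (s, i) then r i s else 0) - (if t = (i, s) then r s i else 0)" for t
    proof (cases t)
      case (Pair p q)
      have "r q p * of_bool (i = q \<and> s = p) = (if t = (s, i) then r i s else 0)"
        "r q p * of_bool (i = p \<and> s = q) = (if t = (i, s) then r s i else 0)"
        by (auto simp: Pair)
      then show ?thesis by (simp only: Pair prod.case skew_unit_def right_diff_distrib)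
    qed
    have "(\<Sum>(p, q)\<in>?L. r q p * skew_unit p q i s) =
        (\<Sum>t\<in>?L. if t = (s, i) then r i s else 0) - (\<Sum>t\<in>?L. if t = (i, s) then r s i else 0)"
      unfolding sum_subtractf[symmetric] by (intro sum.cong refl pt)
    also have "\<dots> = (if e s < e i then r i s else 0) - (if e i < e s then r s i else 0)"
      by (simp add: sum.delta)
    also have "\<dots> = r i s"
    proof -
      have "r i s = - r s i" using assms(2) unfolding skew_def by blast
      moreover have "r i s = 0" if "e i = e s"
        using injD[OF assms(1) that] skew_diag[OF assms(2)] by simp
      ultimately show ?thesis by (cases "e i" "e s" rule: linorder_cases) auto
    qed
    finally show ?thesis by simp
  qed
  have "act3 r T = (\<Sum>t\<in>?L. r (snd t) (fst t) *s act3 (skew_unit (fst t) (snd t)) T)"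
  proof -
    have "act3 r T $ (i, j, k) =
        (\<Sum>t\<in>?L. r (snd t) (fst t) *s act3 (skew_unit (fst t) (snd t)) T) $ (i, j, k)" for i j k
    proof -
      have "act3 r T $ (i, j, k) = (\<Sum>s\<in>UNIV. \<Sum>t\<in>?L. r (snd t) (fst t) * skew_unit (fst t) (snd t) k s * T $ (i, j, s))"
        unfolding act_nth by (subst r) (simp add: split_def sum_distrib_right)
      also have "\<dots> = (\<Sum>t\<in>?L. \<Sum>s\<in>UNIV. r (snd t) (fst t) * skew_unit (fst t) (snd t) k s * T $ (i, j, s))"
        by (rule sum.swap)
      finally show ?thesis by (simp add: sum_distrib_left mult.assoc)
    qed
    then show ?thesis by (simp add: vec_eq_iff)
  qed
  also have "\<dots> \<in> vec.span ((\<lambda>(p, q). act3 (skew_unit p q) T) ` ?L)"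
    by (intro vec.span_sum vec.span_scale vec.span_base) auto
  finally show ?thesis .
qed

text \<open>The hypothesis is four times a dimension count, with the subtractions moved across: the
  unknowns in \<open>G\<close> minus the coefficients of a biquadratic form exceed the number of
  elementary skew matrices on the third factor.\<close>

lemma exists_extra_equation:
  fixes T :: "('i::finite, 'j::finite, 'k::finite) tensor"
  assumes "(CARD('i) * CARD('i) + CARD('i)) * (CARD('j) * CARD('j) + CARD('j))
      + 2 * (CARD('k) * CARD('k)) < 4 * (CARD('i) * CARD('j) * CARD('k)) + 2 * CARD('k)"
  obtains G where "\<And>x y. contraction_form T G x y = 0" "\<And>r. skew r \<Longrightarrow> G \<noteq> act3 r T"
proof -
  obtain ei :: "'i \<Rightarrow> nat" and ej :: "'j \<Rightarrow> nat" and ek :: "'k \<Rightarrow> nat"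
    where e: "inj ei" "inj ej" "inj ek" using ex_inj_nat by metis
  let ?I = "{(p, q). ei p \<le> ei q}" and ?J = "{(p, q). ej p \<le> ej q}" and ?K = "{(p, q). ek p < ek q}"
  \<comment> \<open>Only ordered pairs are listed, as the count requires; the other equations agree
    with these by \<open>polar_equation_commute\<close>.\<close>
  define C where "C = (\<lambda>((i, i'), (j, j')). polar_equation T i i' j j') ` (?I \<times> ?J)"
  define S where "S = {G. \<forall>c\<in>C. pairing c G = 0}"
  define B where "B = (\<lambda>(p, q). act3 (skew_unit p q) T) ` ?K"
  have form: "contraction_form T G x y = 0" if "G \<in> S" for G x y
  proof (rule contraction_form_eq_0)
    have le: "pairing (polar_equation T i i' j j') G = 0" if "ei i \<le> ei i'" "ej j \<le> ej j'" for i i' j j'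
      using \<open>G \<in> S\<close> that unfolding S_def C_def by force
    show "pairing (polar_equation T i i' j j') G = 0" for i i' j j'
      by (cases "ei i \<le> ei i'"; cases "ej j \<le> ej j'")
        (metis le nat_le_linear polar_equation_commute)+
  qed
  have "card C \<le> card ?I * card ?J"
    unfolding C_def card_cartesian_product[symmetric] by (rule card_image_le) simp
  moreover have "CARD('i) * CARD('j) * CARD('k) \<le> vec.dim S + card C"
    using dim_annihilator_ge[of C] unfolding S_def by (simp add: C_def mult.assoc)
  moreover have "card B \<le> card ?K"
    unfolding B_def by (rule card_image_le) simp
  moreover have "4 * (card ?I * card ?J) = (2 * card ?I) * (2 * card ?J)" by simp
  ultimately have "card B < vec.dim S"
    using assms card_le_pairs[OF e(1)] card_le_pairs[OF e(2)] card_less_pairs[OF e(3)] by simp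
  then have "\<not> S \<subseteq> vec.span B"
    using vec.dim_le_card[of S B] by (auto simp: B_def)
  then obtain G where "G \<in> S" "G \<notin> vec.span B" by blast
  moreover have "act3 r T \<in> vec.span B" if "skew r" for r
    unfolding B_def by (rule act3_skew_in_span[OF e(3) that])
  ultimately show ?thesis using that form by metis
qed

section \<open>General tensors have no rank-one kernel\<close>

lemma polynomial_fun_contract3: "polynomial_fun (\<lambda>T. contract3 T x y $ k)"
  unfolding contract3_def vec_lambda_beta by (intro polynomial_fun_intros)

section \<open>Elimination by monomials\<close>

text \<open>
  In the application, \<open>V p q s\<close> is the value on \<open>x\<^sub>0\<^sup>p x\<^sub>1\<^bsup>b+1-p-q\<^esup> x\<^sub>2\<^sup>q y\<^sub>s\<close> of a linear form that annihilates
  the ideal generated by the coefficients of \<open>(\<Sum> x\<^sub>i t\<^sup>i) (\<Sum> y\<^sub>j t\<^sup>j)\<close>.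
\<close>

lemma toeplitz_vanishing:
  fixes V :: "nat \<Rightarrow> nat \<Rightarrow> int \<Rightarrow> complex"
  assumes rec: "\<And>p q s. p + q \<le> b \<Longrightarrow> V (p + 1) q s + V p q (s - 1) + V p (q + 1) (s - 2) = 0"
    and neg: "\<And>p q s. s < 0 \<Longrightarrow> V p q s = 0"
    and big: "\<And>p q s. s > int b \<Longrightarrow> V p q s = 0"
    and pq: "p + q \<le> b + 1"
  shows "V p q s = 0"
proof -
  \<comment> \<open>Solving the recursion for its first term raises \<open>p\<close> and lowers
    \<open>s\<close> by at least one each time relative to the bound, starting from negative
    \<open>s\<close>; \<open>high\<close> is the mirror image in \<open>q\<close>, starting above
    \<open>b\<close>.\<close>
  have low: "V p q s = 0" if "p + q \<le> b + 1" "s < int p" for p q s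
    using that
  proof (induction p arbitrary: q s)
    case 0
    then show ?case using neg by simp
  next
    case (Suc p)
    have "V p q (s - 1) = 0" "V p (q + 1) (s - 2) = 0"
      using Suc.prems by (auto intro: Suc.IH)
    then show ?case using rec[of p q s] Suc.prems by simp
  qed
  have high: "V p q s = 0" if "p + q \<le> b + 1" "int b - s < int q" for p q s
    using that
  proof (induction q arbitrary: p s)
    case 0
    then show ?case using big by simp
  next
    case (Suc q)
    have "V p q (s + 1) = 0" "V (p + 1) q (s + 2) = 0"
      using Suc.prems by (auto intro: Suc.IH)
    then show ?case using rec[of p q "s + 2"] Suc.prems by (simp add: add.commute)
  qed
  show ?thesis
    using pq
  proof (induction "b + 1 - p - q" arbitrary: p q s)
    case 0
    \<comment> \<open>Here \<open>p + q = b + 1\<close>, whereas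
      \<open>p \<le> s \<le> b - q\<close> would give \<open>p + q \<le> b\<close>. From this case
      the middle term of the recursion yields the rest by induction on the exponent of
      \<open>x_1\<close>.\<close>
    then have "s < int p \<or> int b - s < int q" by linarith
    with 0 show ?case using low high by blast
  next
    case (Suc d)
    then have *: "d = b + 1 - (p + 1) - q" "d = b + 1 - p - (q + 1)" "p + q \<le> b" by linarith+
    have "V (p + 1) q (s + 1) = 0" using *(1,3) by (intro Suc.hyps(1)) auto
    moreover have "V p (q + 1) (s - 1) = 0" using *(2,3) by (intro Suc.hyps(1)) auto
    ultimately show ?case using rec[of p q "s + 1"] *(3) by simp
  qed
qed

text \<open>Multiplying the equations \<open>contract3 T x y = 0\<close> by all monomials of degree
  \<open>b\<close> in \<open>x\<close> gives a linear system for the products of a monomial of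
  degree \<open>b + 1\<close> in \<open>x\<close> with some \<open>y_j\<close>. If this system is
  injective, all these products vanish, hence \<open>x = 0\<close> or \<open>y = 0\<close>.
  Injectivity is open and is checked at one tensor.\<close>

lemma generic_no_rank_one_kernel:
  assumes "CARD('i::finite) = 3" "CARD('j::finite) = b + 1" "b + 3 \<le> CARD('k::finite)"
  shows "\<exists>f T\<^sub>0. polynomial_fun f \<and> f T\<^sub>0 \<noteq> 0 \<and>
    (\<forall>T :: ('i, 'j, 'k) tensor. f T \<noteq> 0 \<longrightarrow> (\<forall>x y. contract3 T x y = 0 \<longrightarrow> x = 0 \<or> y = 0))"
proof -
  obtain i0 i1 i2 :: 'i where i: "UNIV = {i0, i1, i2}" "i0 \<noteq> i1" "i1 \<noteq> i2" "i0 \<noteq> i2"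
    using assms(1) unfolding card_3_iff by metis
  obtain ej :: "'j \<Rightarrow> nat" where ej: "bij_betw ej UNIV {0..<b + 1}"
    using ex_bij_betw_finite_nat[of "UNIV :: 'j set"] assms(2) by auto
  obtain ek :: "'k \<Rightarrow> nat" where ek: "bij_betw ek UNIV {0..<CARD('k)}"
    using ex_bij_betw_finite_nat[of "UNIV :: 'k set"] by auto
  \<comment> \<open>\<open>(p, q)\<close> stands for the monomial
    \<open>x_0^p x_1^(b+1-p-q) x_2^q\<close>.\<close>
  define M where "M = {(p, q). p + q \<le> b + 1}"
  have finM: "finite M"
    by (rule finite_subset[of _ "{..b + 1} \<times> {..b + 1}"]) (auto simp: M_def)
  \<comment> \<open>Row \<open>(p, q, k)\<close> is coordinate \<open>k\<close> of the contraction
    times \<open>x_0^p x_1^(b-p-q) x_2^q\<close>; rows with \<open>p + q > b\<close> are filled with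
    zeros.\<close>
  define A :: "nat \<times> nat \<times> 'k \<Rightarrow> (nat \<times> nat) \<times> 'j \<Rightarrow> ('i, 'j, 'k) tensor \<Rightarrow> complex" where
    "A = (\<lambda>(p, q, k) (n, j) T. if p + q \<le> b then
        (if n = (p + 1, q) then T $ (i0, j, k) else 0) + (if n = (p, q) then T $ (i1, j, k) else 0)
        + (if n = (p, q + 1) then T $ (i2, j, k) else 0) else 0)"
  have polyA: "polynomial_fun (A r c)" for r c
    unfolding A_def split_def by (intro polynomial_fun_intros)
  have row: "(\<Sum>c\<in>M \<times> UNIV. A (p, q, k) c T * w c) =
      (\<Sum>j\<in>UNIV. T $ (i0, j, k) * w ((p + 1, q), j) + T $ (i1, j, k) * w ((p, q), j)
        + T $ (i2, j, k) * w ((p, q + 1), j))" if pq: "p + q \<le> b" for p q k T w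
  proof -
    have "(\<Sum>c\<in>M \<times> UNIV. A (p, q, k) c T * w c) = (\<Sum>n\<in>M. \<Sum>j\<in>UNIV. A (p, q, k) (n, j) T * w (n, j))"
      by (simp only: sum.cartesian_product) (simp only: split_def prod.collapse)
    also have "\<dots> = (\<Sum>j\<in>UNIV. \<Sum>n\<in>M. A (p, q, k) (n, j) T * w (n, j))"
      by (rule sum.swap)
    also have "\<dots> = (\<Sum>j\<in>UNIV. \<Sum>n\<in>M. (if n = (p + 1, q) then T $ (i0, j, k) * w ((p + 1, q), j) else 0)
        + (if n = (p, q) then T $ (i1, j, k) * w ((p, q), j) else 0)
        + (if n = (p, q + 1) then T $ (i2, j, k) * w ((p, q + 1), j) else 0))"
      using pq by (intro sum.cong refl) (auto simp: A_def)
    also have "\<dots> = (\<Sum>j\<in>UNIV. T $ (i0, j, k) * w ((p + 1, q), j) + T $ (i1, j, k) * w ((p, q), j)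
        + T $ (i2, j, k) * w ((p, q + 1), j))"
      using finM pq by (simp add: sum.distrib M_def)
    finally show ?thesis .
  qed
  \<comment> \<open>multiplication of a quadratic polynomial by a polynomial of degree \<open>b\<close>\<close>
  define T\<^sub>0 :: "('i, 'j, 'k) tensor" where
    "T\<^sub>0 = vec_lambda (\<lambda>(i, j, k). of_bool (ek k = (if i = i0 then 0 else if i = i1 then 1 else 2) + ej j))"
  have "\<exists>f. polynomial_fun f \<and> f T\<^sub>0 \<noteq> 0 \<and> (\<forall>T. f T \<noteq> 0 \<longrightarrow>
      (\<forall>w. (\<forall>r. (\<Sum>c\<in>M \<times> UNIV. A r c T * w c) = 0) \<longrightarrow> (\<forall>c\<in>M \<times> UNIV. w c = 0)))"
  proof (rule generic_injective)
    show "finite (M \<times> UNIV :: ((nat \<times> nat) \<times> 'j) set)" using finM by simp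
    show "polynomial_fun (A r c)" for r c by (rule polyA)
  next
    fix w :: "(nat \<times> nat) \<times> 'j \<Rightarrow> complex" and c :: "(nat \<times> nat) \<times> 'j"
    assume w: "\<And>r. (\<Sum>c\<in>M \<times> UNIV. A r c T\<^sub>0 * w c) = 0" and c: "c \<in> M \<times> UNIV"
    \<comment> \<open>Indexing \<open>y\<close> by its degree \<open>s\<close>, with value 0 outside
      \<open>0..b\<close>, allows shifts of \<open>s\<close> without case distinctions.\<close>
    define V where "V p q s = (\<Sum>j\<in>UNIV. of_bool (int (ej j) = s) * w ((p, q), j))" for p q s
    obtain p q j where c': "c = ((p, q), j)" "p + q \<le> b + 1"
      using c by (auto simp: M_def)
    have ejb: "ej j \<le> b" for j
      using bij_betwE[OF ej] by (auto simp: less_Suc_eq_le)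
    have V_out: "V p q s = 0" if "s < 0 \<or> int b < s" for p q s
    proof -
      have "int (ej j) \<noteq> s" for j using that ejb[of j] by linarith
      then show ?thesis by (simp add: V_def)
    qed
    have "V p q (int (ej j)) = 0"
    proof (rule toeplitz_vanishing[OF _ _ _ c'(2)])
      show "V p q s = 0" if "s < 0" for p q s
        using that V_out by blast
      show "V p q s = 0" if "int b < s" for p q s
        using that V_out by blast
      fix p q s assume pq: "p + q \<le> b"
      show "V (p + 1) q s + V p q (s - 1) + V p (q + 1) (s - 2) = 0"
      \<comment> \<open>In this range some \<open>k\<close> represents the power \<open>t^s\<close>,
        because \<open>b + 3 \<le> CARD('k)\<close>; outside it all three terms are zero.\<close>
      proof (cases "0 \<le> s \<and> s \<le> int b + 2")
        case True
        then have "nat s \<in> ek ` UNIV"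
          using ek assms(3) unfolding bij_betw_def by auto
        then obtain k where "nat s = ek k" by blast
        with True have k: "int (ek k) = s" by linarith
        have T: "T\<^sub>0 $ (i0, j, k) = of_bool (int (ej j) = s)"
          "T\<^sub>0 $ (i1, j, k) = of_bool (int (ej j) = s - 1)"
          "T\<^sub>0 $ (i2, j, k) = of_bool (int (ej j) = s - 2)" for j
          using i by (auto simp: T\<^sub>0_def k[symmetric])
        show ?thesis
          using w[of "(p, q, k)"] unfolding row[OF pq] T V_def by (simp only: sum.distrib)
      next
        case False
        then have "V (p + 1) q s = 0" "V p q (s - 1) = 0" "V p (q + 1) (s - 2) = 0"
          by (auto intro: V_out)
        then show ?thesis by simp
      qed
    qed
    moreover have "V p q (int (ej j)) = w ((p, q), j)"
    proof -
      have "int (ej j') = int (ej j) \<longleftrightarrow> j' = j" for j'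
        using ej by (auto simp: bij_betw_def inj_on_def)
      then show ?thesis unfolding V_def by (simp add: of_bool_def if_distrib[where f = "\<lambda>c. c * _"] cong: if_cong)
    qed
    ultimately show "w c = 0" using c' by simp
  qed
  then obtain f where f: "polynomial_fun f" "f T\<^sub>0 \<noteq> 0"
    and inj: "\<And>T w c. f T \<noteq> 0 \<Longrightarrow> (\<And>r. (\<Sum>c\<in>M \<times> UNIV. A r c T * w c) = 0) \<Longrightarrow> c \<in> M \<times> UNIV \<Longrightarrow> w c = 0"
    by blast
  have "x = 0 \<or> y = 0" if T: "f T \<noteq> 0" and xy: "contract3 T x y = 0" for T x y
  proof (rule disjCI)
    assume "y \<noteq> 0"
    then obtain j where j: "y $ j \<noteq> 0" by (auto simp: vec_eq_iff)
    define w where "w = (\<lambda>((p, q), j). x $ i0 ^ p * x $ i1 ^ (b + 1 - p - q) * x $ i2 ^ q * y $ j)"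
    have "(\<Sum>c\<in>M \<times> UNIV. A r c T * w c) = 0" for r
    proof (cases r)
      case (fields p q k)
      show ?thesis
      proof (cases "p + q \<le> b")
        case True
        then have d: "b + 1 - p - q = Suc (b - p - q)" "b + 1 - (p + 1) - q = b - p - q"
          "b + 1 - p - (q + 1) = b - p - q" by auto
        have "(\<Sum>c\<in>M \<times> UNIV. A r c T * w c) =
            (\<Sum>j\<in>UNIV. x $ i0 ^ p * x $ i1 ^ (b - p - q) * x $ i2 ^ q *
              ((\<Sum>i\<in>UNIV. T $ (i, j, k) * x $ i * y $ j)))"
          unfolding fields row[OF True] w_def prod.case d i(1)
          using i(2-) by (intro sum.cong refl) (simp add: algebra_simps)
        also have "\<dots> = x $ i0 ^ p * x $ i1 ^ (b - p - q) * x $ i2 ^ q * contract3 T x y $ k"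
          unfolding sum_distrib_left[symmetric] contract3_def
          by (subst sum.swap) simp
        finally show ?thesis using xy by simp
      next
        case False
        then show ?thesis by (simp add: fields A_def split_def)
      qed
    qed
    note w0 = inj[OF T this]
    \<comment> \<open>The pure powers of the three coordinates of \<open>x\<close>, each times the
      nonzero \<open>y $ j\<close>.\<close>
    have "w ((b + 1, 0), j) = 0" "w ((0, 0), j) = 0" "w ((0, b + 1), j) = 0"
      by (rule w0; simp add: M_def)+
    then have "x $ i0 = 0" "x $ i1 = 0" "x $ i2 = 0"
      using j by (auto simp: w_def)
    moreover have "i = i0 \<or> i = i1 \<or> i = i2" for i using i(1) by auto
    ultimately show "x = 0" by (metis vec_eq_iff zero_index)
  qed
  with f show ?thesis by blast
qed

section \<open>General tensors have trivial stabiliser\<close>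

lemma contract3_axis_left:
  "contract3 T x y $ k = (\<Sum>s\<in>UNIV. x $ s * contract3 T (axis s 1) y $ k)"
proof -
  have "contract3 T (axis s 1) y $ k = (\<Sum>j\<in>UNIV. T $ (s, j, k) * y $ j)" for s
  proof -
    have "contract3 T (axis s 1) y $ k = (\<Sum>i\<in>UNIV. if i = s then \<Sum>j\<in>UNIV. T $ (s, j, k) * y $ j else 0)"
      unfolding contract3_def vec_lambda_beta by (intro sum.cong refl) (simp add: axis_def)
    then show ?thesis by simp
  qed
  then show ?thesis by (simp add: contract3_def sum_distrib_left mult_ac)
qed

lemma contract3_axis_right:
  "contract3 T x y $ k = (\<Sum>s\<in>UNIV. y $ s * contract3 T x (axis s 1) $ k)"
proof -
  have "contract3 T x (axis s 1) $ k = (\<Sum>i\<in>UNIV. T $ (i, s, k) * x $ i)" for s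
  proof -
    have "contract3 T x (axis s 1) $ k = (\<Sum>j\<in>UNIV. \<Sum>i\<in>UNIV. T $ (i, j, k) * x $ i * axis s 1 $ j)"
      unfolding contract3_def vec_lambda_beta by (rule sum.swap)
    also have "\<dots> = (\<Sum>j\<in>UNIV. if j = s then \<Sum>i\<in>UNIV. T $ (i, s, k) * x $ i else 0)"
      by (intro sum.cong refl) (simp add: axis_def)
    finally show ?thesis by simp
  qed
  moreover have "contract3 T x y $ k = (\<Sum>j\<in>UNIV. \<Sum>i\<in>UNIV. T $ (i, j, k) * x $ i * y $ j)"
    unfolding contract3_def vec_lambda_beta by (rule sum.swap)
  ultimately show ?thesis by (simp add: sum_distrib_left mult_ac)
qed

text \<open>Shifting the action from the tensor to its argument transposes \<open>m\<close>.\<close>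

lemma contract3_act1: "contract3 (act1 m T) x y = contract3 T (\<chi> s. \<Sum>i\<in>UNIV. m i s * x $ i) y"
proof -
  have "contract3 (act1 m T) x y $ k = contract3 T (\<chi> s. \<Sum>i\<in>UNIV. m i s * x $ i) y $ k" for k
  proof -
    have "contract3 (act1 m T) x y $ k =
        (\<Sum>i\<in>UNIV. \<Sum>j\<in>UNIV. \<Sum>s\<in>UNIV. T $ (s, j, k) * (m i s * x $ i) * y $ j)"
      by (simp add: contract3_def sum_distrib_right sum_distrib_left mult_ac)
    also have "\<dots> = (\<Sum>i\<in>UNIV. \<Sum>s\<in>UNIV. \<Sum>j\<in>UNIV. T $ (s, j, k) * (m i s * x $ i) * y $ j)"
      by (intro sum.cong refl sum.swap)
    also have "\<dots> = (\<Sum>s\<in>UNIV. \<Sum>i\<in>UNIV. \<Sum>j\<in>UNIV. T $ (s, j, k) * (m i s * x $ i) * y $ j)"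
      by (rule sum.swap)
    also have "\<dots> = (\<Sum>s\<in>UNIV. \<Sum>j\<in>UNIV. \<Sum>i\<in>UNIV. T $ (s, j, k) * (m i s * x $ i) * y $ j)"
      by (intro sum.cong refl sum.swap)
    finally show ?thesis by (simp add: contract3_def sum_distrib_right sum_distrib_left)
  qed
  then show ?thesis by (simp add: vec_eq_iff)
qed

lemma contract3_act2: "contract3 (act2 n T) x y = contract3 T x (\<chi> s. \<Sum>j\<in>UNIV. n j s * y $ j)"
proof -
  have "contract3 (act2 n T) x y $ k = contract3 T x (\<chi> s. \<Sum>j\<in>UNIV. n j s * y $ j) $ k" for k
  proof -
    have "contract3 (act2 n T) x y $ k =
        (\<Sum>i\<in>UNIV. \<Sum>j\<in>UNIV. \<Sum>s\<in>UNIV. T $ (i, s, k) * x $ i * (n j s * y $ j))"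
      by (simp add: contract3_def sum_distrib_right sum_distrib_left mult_ac)
    also have "\<dots> = (\<Sum>i\<in>UNIV. \<Sum>s\<in>UNIV. \<Sum>j\<in>UNIV. T $ (i, s, k) * x $ i * (n j s * y $ j))"
      by (intro sum.cong refl sum.swap)
    finally show ?thesis by (simp add: contract3_def sum_distrib_left)
  qed
  then show ?thesis by (simp add: vec_eq_iff)
qed

text \<open>The contraction form here is half the derivative of the biquadratic form
  \<open>|\<phi>(x \<otimes> y)|^2\<close> along the transposes of \<open>m\<close> and
  \<open>n\<close>. So no nonzero pair of skew matrices preserves that form infinitesimally.\<close>

definition trivial_stabiliser :: "('i::finite, 'j::finite, 'k::finite) tensor \<Rightarrow> bool" where
  "trivial_stabiliser T \<longleftrightarrow> (\<forall>m n. skew m \<and> skew n \<and>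
     (\<forall>x y. contraction_form T (act1 m T + act2 n T) x y = 0) \<longrightarrow>
     (\<forall>p q. m p q = 0) \<and> (\<forall>p q. n p q = 0))"

text \<open>A nearly diagonal form suffices: distinct weights on the squares of the
  \<open>y_j\<close> rigidify the second factor, and the extra square, placed at a spare index
  \<open>k'\<close> of the third factor, separates \<open>x_1\<close> from
  \<open>x_2\<close>.\<close>

lemma exists_trivial_stabiliser:
  assumes "CARD('i::finite) = 3" "2 \<le> CARD('j::finite)" "CARD('j) < CARD('k::finite)"
  shows "\<exists>T :: ('i, 'j, 'k) tensor. trivial_stabiliser T"
proof -
  obtain i0 i1 i2 :: 'i where i: "UNIV = {i0, i1, i2}" "i0 \<noteq> i1" "i1 \<noteq> i2" "i0 \<noteq> i2"
    using assms(1) unfolding card_3_iff by metis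
  obtain e :: "'j \<Rightarrow> nat" where e: "inj e" using ex_inj_nat by blast
  obtain j0 j1 :: 'j where j: "j0 \<noteq> j1"
    using assms(2) by (metis card_2_iff' ex_card UNIV_I)
  obtain \<kappa> :: "'j \<Rightarrow> 'k" where \<kappa>: "inj \<kappa>"
    using card_le_inj[of "UNIV :: 'j set" "UNIV :: 'k set"] assms(3) by auto
  have "card (range \<kappa>) < CARD('k)" using assms(3) \<kappa> by (simp add: card_image)
  then obtain k' where k': "k' \<notin> range \<kappa>" by (metis UNIV_eq_I less_irrefl)
  \<comment> \<open>The shift by one makes the weights nonzero; being positive and distinct, they
    also have distinct squares.\<close>
  define \<mu> :: "'j \<Rightarrow> complex" where "\<mu> j = of_nat (e j + 1)" for j
  have \<mu>: "\<mu> j \<noteq> 0" "(\<mu> p)\<^sup>2 = (\<mu> q)\<^sup>2 \<Longrightarrow> p = q" for j p q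
  proof -
    show "\<mu> j \<noteq> 0" unfolding \<mu>_def by (metis of_nat_eq_0_iff Suc_eq_plus1 nat.distinct(1))
    assume "(\<mu> p)\<^sup>2 = (\<mu> q)\<^sup>2"
    then have "(e p + 1)\<^sup>2 = (e q + 1)\<^sup>2"
      unfolding \<mu>_def of_nat_power[symmetric] of_nat_eq_iff .
    then have "e p = e q" by (simp add: power2_eq_iff_nonneg)
    then show "p = q" using e by (simp add: inj_def)
  qed
  \<comment> \<open>the form \<open>|\<phi>(x \<otimes> y)|\<^sup>2\<close> is \<open>x\<^sub>0\<^sup>2 \<Sum> \<mu>\<^sub>j\<^sup>2 y\<^sub>j\<^sup>2 + x\<^sub>1\<^sup>2 y\<^sub>1\<^sup>2\<close>\<close>
  define T :: "('i, 'j, 'k) tensor" where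
    "T = vec_lambda (\<lambda>(i, j, k). (if i = i0 \<and> k = \<kappa> j then \<mu> j else 0)
       + (if i = i1 \<and> j = j1 \<and> k = k' then 1 else 0))"
  have c\<kappa>: "contract3 T x y $ \<kappa> j = \<mu> j * x $ i0 * y $ j" for x y j
  proof -
    have "T $ (s, t, \<kappa> j) * x $ s * y $ t =
        (if t = j then if s = i0 then \<mu> j * x $ i0 * y $ j else 0 else 0)" for s t
      using k' \<kappa> by (auto simp: T_def inj_eq)
    then show ?thesis by (simp add: contract3_def)
  qed
  have ck': "contract3 T x y $ k' = x $ i1 * y $ j1" for x y
  proof -
    have "T $ (s, t, k') * x $ s * y $ t =
        (if t = j1 then if s = i1 then x $ i1 * y $ j1 else 0 else 0)" for s t
      using k' by (auto simp: T_def)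
    then show ?thesis by (simp add: contract3_def)
  qed
  have c0: "contract3 T x y $ k = 0" if "k \<notin> insert k' (range \<kappa>)" for x y k
    unfolding contract3_def vec_lambda_beta
    using that by (intro sum.neutral ballI) (auto simp: T_def)
  have form: "(\<Sum>k\<in>UNIV. contract3 T x y $ k * contract3 T u v $ k) =
      x $ i0 * u $ i0 * (\<Sum>j\<in>UNIV. (\<mu> j)\<^sup>2 * y $ j * v $ j) + x $ i1 * u $ i1 * y $ j1 * v $ j1" for x y u v
  proof -
    have "(\<Sum>k\<in>UNIV. contract3 T x y $ k * contract3 T u v $ k) =
        (\<Sum>k\<in>insert k' (range \<kappa>). contract3 T x y $ k * contract3 T u v $ k)"
      by (rule sum.mono_neutral_right) (auto simp: c0)
    also have "\<dots> = contract3 T x y $ k' * contract3 T u v $ k' +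
        (\<Sum>j\<in>UNIV. contract3 T x y $ \<kappa> j * contract3 T u v $ \<kappa> j)"
      using k' \<kappa> by (simp add: sum.reindex)
    finally show ?thesis
      by (simp add: c\<kappa> ck' sum_distrib_left power2_eq_square mult_ac)
  qed
  have "(\<forall>p q. m p q = 0) \<and> (\<forall>p q. n p q = 0)"
    if m: "skew m" and n: "skew n"
      and stab: "\<And>x y. contraction_form T (act1 m T + act2 n T) x y = 0" for m n
  proof -
    have E: "x $ i0 * (\<Sum>i\<in>UNIV. m i i0 * x $ i) * (\<Sum>j\<in>UNIV. (\<mu> j)\<^sup>2 * y $ j * y $ j)
        + x $ i1 * (\<Sum>i\<in>UNIV. m i i1 * x $ i) * y $ j1 * y $ j1
        + (x $ i0 * x $ i0 * (\<Sum>j\<in>UNIV. (\<mu> j)\<^sup>2 * y $ j * (\<Sum>t\<in>UNIV. n t j * y $ t))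
        + x $ i1 * x $ i1 * y $ j1 * (\<Sum>t\<in>UNIV. n t j1 * y $ t)) = 0" for x y
      using stab[of x y]
      by (simp add: contraction_form_def contract3_add contract3_act1 contract3_act2
          distrib_left sum.distrib form)
    have d: "(\<Sum>i\<in>UNIV. F i * axis s 1 $ i) = F s" for F :: "'b::finite \<Rightarrow> complex" and s
      by (simp add: axis_def if_distrib[where f = "\<lambda>c. _ * c"] cong: if_cong)
    have d2: "(\<Sum>i\<in>UNIV. F i * (axis s 1 + axis t 1) $ i) = F s + F t"
      for F :: "'b::finite \<Rightarrow> complex" and s t
      by (simp add: distrib_left sum.distrib d)
    \<comment> \<open>Testing at \<open>x = e_i0\<close>, \<open>y = e_p + e_q\<close> leaves
      \<open>n q p\<close> times the difference of two squared weights.\<close>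
    have n0: "n q p = 0" for p q
    proof (cases "p = q")
      case True
      then show ?thesis using skew_diag[OF n] by simp
    next
      case False
      let ?y = "axis p 1 + axis q 1 :: complex ^ 'j"
      have inner: "(\<Sum>t\<in>UNIV. n t j * ?y $ t) = n p j + n q j" for j
        by (rule d2)
      have npq: "n p q = - n q p" using n unfolding skew_def by blast
      have "(\<Sum>j\<in>UNIV. (\<mu> j)\<^sup>2 * ?y $ j * (\<Sum>t\<in>UNIV. n t j * ?y $ t)) = 0"
        using E[of "axis i0 1" ?y] i(2) by (simp only: d skew_diag[OF m]) (simp add: axis_def)
      also have "(\<Sum>j\<in>UNIV. (\<mu> j)\<^sup>2 * ?y $ j * (\<Sum>t\<in>UNIV. n t j * ?y $ t)) =
          (\<Sum>j\<in>UNIV. (\<mu> j)\<^sup>2 * (n p j + n q j) * ?y $ j)"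
        unfolding inner by (simp only: mult_ac)
      also have "\<dots> = (\<mu> p)\<^sup>2 * n q p + (\<mu> q)\<^sup>2 * n p q"
        unfolding d2 by (simp add: skew_diag[OF n])
      also have "\<dots> = ((\<mu> p)\<^sup>2 - (\<mu> q)\<^sup>2) * n q p"
        unfolding npq by (simp add: left_diff_distrib)
      finally show ?thesis using \<mu>(2)[of p q] False by auto
    qed
    \<comment> \<open>With \<open>n\<close> gone, \<open>x = e_i0 + e_i\<close> and
      \<open>y = e_j0\<close> are tested; \<open>j0 \<noteq> j1\<close> removes the extra
      square.\<close>
    have m0: "m i i0 = 0" for i
    proof (cases "i = i0")
      case True
      then show ?thesis using skew_diag[OF m] by simp
    next
      case False
      have "(axis i0 1 + axis i 1 :: complex ^ 'i) $ i0 = 1" using False by (simp add: axis_def)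
      moreover have "(\<Sum>j\<in>UNIV. (\<mu> j)\<^sup>2 * axis j0 1 $ j * axis j0 1 $ j) = (\<mu> j0)\<^sup>2"
        unfolding d by (simp add: axis_def)
      moreover have "axis j0 (1 :: complex) $ j1 = 0" using j by (simp add: axis_def)
      ultimately have "m i i0 * (\<mu> j0)\<^sup>2 = 0"
        using E[of "axis i0 1 + axis i 1" "axis j0 1"]
        by (simp only: d2 skew_diag[OF m] n0) simp
      then show ?thesis using \<mu>(1) by simp
    qed
    \<comment> \<open>Only the extra square sees \<open>x = e_i1 + e_i2\<close>,
      \<open>y = e_j1\<close>, since \<open>x $ i0 = 0\<close>.\<close>
    have m2: "m i2 i1 = 0"
    proof -
      have "(axis i1 1 + axis i2 1 :: complex ^ 'i) $ i0 = 0" "(axis i1 1 + axis i2 1 :: complex ^ 'i) $ i1 = 1"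
        "axis j1 (1 :: complex) $ j1 = 1" using i by (auto simp: axis_def)
      then show ?thesis
        using E[of "axis i1 1 + axis i2 1" "axis j1 1"]
        by (simp only: d2 skew_diag[OF m] n0) simp
    qed
    have "m p q = 0" for p q
    proof -
      have "p \<in> {i0, i1, i2}" "q \<in> {i0, i1, i2}" using i(1) by auto
      moreover have "m i0 s = - m s i0" "m i1 i2 = - m i2 i1" for s
        using m unfolding skew_def by blast+
      ultimately show ?thesis using m0 m2 skew_diag[OF m] by auto
    qed
    with n0 show ?thesis by simp
  qed
  then have "trivial_stabiliser T" unfolding trivial_stabiliser_def by blast
  then show ?thesis ..
qed

text \<open>Triviality is injectivity of a linear system in the entries of \<open>m\<close> and
  \<open>n\<close> whose coefficients are polynomial in \<open>T\<close>, so
  \<open>generic_injective\<close> applies.\<close>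

lemma generic_trivial_stabiliser:
  assumes "trivial_stabiliser (T\<^sub>1 :: ('i::finite, 'j::finite, 'k::finite) tensor)"
  shows "\<exists>f. polynomial_fun f \<and> f T\<^sub>1 \<noteq> 0 \<and>
    (\<forall>T :: ('i, 'j, 'k) tensor. f T \<noteq> 0 \<longrightarrow> trivial_stabiliser T)"
proof -
  \<comment> \<open>There is one row for every pair of vectors \<open>(x, y)\<close>, an infinite
    family, expressing that the form vanishes there. The remaining rows, constant in
    \<open>T\<close>, encode skewness; on the diagonal they read \<open>2 * w = 0\<close>.\<close>
  define A :: "(complex ^ 'i) \<times> (complex ^ 'j) + ('i \<times> 'i) + ('j \<times> 'j) \<Rightarrow>
      ('i \<times> 'i) + ('j \<times> 'j) \<Rightarrow> ('i, 'j, 'k) tensor \<Rightarrow> complex" where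
    "A r c T = (case r of
        Inl (x, y) \<Rightarrow> (case c of
            Inl (i, s) \<Rightarrow> x $ i * (\<Sum>k\<in>UNIV. contract3 T x y $ k * contract3 T (axis s 1) y $ k)
          | Inr (j, s) \<Rightarrow> y $ j * (\<Sum>k\<in>UNIV. contract3 T x y $ k * contract3 T x (axis s 1) $ k))
      | Inr (Inl t) \<Rightarrow> (case c of Inl u \<Rightarrow> of_bool (u = t) + of_bool (u = prod.swap t) | Inr _ \<Rightarrow> 0)
      | Inr (Inr t) \<Rightarrow> (case c of Inl _ \<Rightarrow> 0 | Inr u \<Rightarrow> of_bool (u = t) + of_bool (u = prod.swap t)))"
    for r c T
  have polyA: "polynomial_fun (A r c)" for r c
  proof (cases r)
    case (Inl t)
    obtain x y where t: "t = (x, y)" by (cases t)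
    show ?thesis
    proof (cases c)
      case c: (Inl u)
      obtain i s where "u = (i, s)" by (cases u)
      then have "A r c = (\<lambda>T. x $ i * (\<Sum>k\<in>UNIV. contract3 T x y $ k * contract3 T (axis s 1) y $ k))"
        by (simp add: A_def Inl t c fun_eq_iff)
      then show ?thesis by (simp only:) (intro polynomial_fun_intros polynomial_fun_contract3)
    next
      case c: (Inr u)
      obtain j s where "u = (j, s)" by (cases u)
      then have "A r c = (\<lambda>T. y $ j * (\<Sum>k\<in>UNIV. contract3 T x y $ k * contract3 T x (axis s 1) $ k))"
        by (simp add: A_def Inl t c fun_eq_iff)
      then show ?thesis by (simp only:) (intro polynomial_fun_intros polynomial_fun_contract3)
    qed
  next
    case (Inr t)
    then have "A r c = (\<lambda>_. A r c 0)" by (simp add: A_def fun_eq_iff)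
    then show ?thesis by (metis polynomial_fun.const)
  qed
  have sum_split': "(\<Sum>c\<in>UNIV. F c) = (\<Sum>u\<in>UNIV. F (Inl u)) + (\<Sum>u\<in>UNIV. F (Inr u))"
    for F :: "('i \<times> 'i) + ('j \<times> 'j) \<Rightarrow> complex"
    by (subst UNIV_Plus_UNIV[symmetric], subst sum.Plus) (simp_all add: comp_def)
  have sum_split: "(\<Sum>c\<in>UNIV. F c) = (\<Sum>i\<in>UNIV. \<Sum>s\<in>UNIV. F (Inl (i, s))) + (\<Sum>j\<in>UNIV. \<Sum>s\<in>UNIV. F (Inr (j, s)))"
    for F :: "('i \<times> 'i) + ('j \<times> 'j) \<Rightarrow> complex"
  proof -
    have "(\<Sum>u\<in>UNIV. F (Inl u)) = (\<Sum>i\<in>UNIV. \<Sum>s\<in>UNIV. F (Inl (i, s)))"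
      by (simp only: sum.cartesian_product) (simp add: split_def)
    moreover have "(\<Sum>u\<in>UNIV. F (Inr u)) = (\<Sum>j\<in>UNIV. \<Sum>s\<in>UNIV. F (Inr (j, s)))"
      by (simp only: sum.cartesian_product) (simp add: split_def)
    ultimately show ?thesis by (simp add: sum_split')
  qed
  have row: "(\<Sum>c\<in>UNIV. A (Inl (x, y)) c T * w c) =
      contraction_form T (act1 (\<lambda>p q. w (Inl (p, q))) T + act2 (\<lambda>p q. w (Inr (p, q))) T) x y" for x y T w
  proof -
    have "(\<Sum>i\<in>UNIV. \<Sum>s\<in>UNIV. A (Inl (x, y)) (Inl (i, s)) T * w (Inl (i, s))) =
        (\<Sum>k\<in>UNIV. contract3 T x y $ k * contract3 (act1 (\<lambda>p q. w (Inl (p, q))) T) x y $ k)"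
    proof -
      let ?g = "\<lambda>i s k. contract3 T x y $ k * (w (Inl (i, s)) * x $ i * contract3 T (axis s 1) y $ k)"
      have "(\<Sum>i\<in>UNIV. \<Sum>s\<in>UNIV. A (Inl (x, y)) (Inl (i, s)) T * w (Inl (i, s))) =
          (\<Sum>i\<in>UNIV. \<Sum>s\<in>UNIV. \<Sum>k\<in>UNIV. ?g i s k)"
        by (simp add: A_def sum_distrib_left sum_distrib_right mult_ac)
      also have "\<dots> = (\<Sum>s\<in>UNIV. \<Sum>i\<in>UNIV. \<Sum>k\<in>UNIV. ?g i s k)"
        by (rule sum.swap)
      also have "\<dots> = (\<Sum>s\<in>UNIV. \<Sum>k\<in>UNIV. \<Sum>i\<in>UNIV. ?g i s k)"
        by (intro sum.cong refl sum.swap)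
      also have "\<dots> = (\<Sum>k\<in>UNIV. \<Sum>s\<in>UNIV. \<Sum>i\<in>UNIV. ?g i s k)"
        by (rule sum.swap)
      finally show ?thesis
        unfolding contract3_act1
          contract3_axis_left[of T "\<chi> s. \<Sum>i\<in>UNIV. w (Inl (i, s)) * x $ i"]
        by (simp only: vec_lambda_beta sum_distrib_right sum_distrib_left)
    qed
    moreover have "(\<Sum>j\<in>UNIV. \<Sum>s\<in>UNIV. A (Inl (x, y)) (Inr (j, s)) T * w (Inr (j, s))) =
        (\<Sum>k\<in>UNIV. contract3 T x y $ k * contract3 (act2 (\<lambda>p q. w (Inr (p, q))) T) x y $ k)"
    proof -
      let ?g = "\<lambda>j s k. contract3 T x y $ k * (w (Inr (j, s)) * y $ j * contract3 T x (axis s 1) $ k)"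
      have "(\<Sum>j\<in>UNIV. \<Sum>s\<in>UNIV. A (Inl (x, y)) (Inr (j, s)) T * w (Inr (j, s))) =
          (\<Sum>j\<in>UNIV. \<Sum>s\<in>UNIV. \<Sum>k\<in>UNIV. ?g j s k)"
        by (simp add: A_def sum_distrib_left sum_distrib_right mult_ac)
      also have "\<dots> = (\<Sum>s\<in>UNIV. \<Sum>j\<in>UNIV. \<Sum>k\<in>UNIV. ?g j s k)"
        by (rule sum.swap)
      also have "\<dots> = (\<Sum>s\<in>UNIV. \<Sum>k\<in>UNIV. \<Sum>j\<in>UNIV. ?g j s k)"
        by (intro sum.cong refl sum.swap)
      also have "\<dots> = (\<Sum>k\<in>UNIV. \<Sum>s\<in>UNIV. \<Sum>j\<in>UNIV. ?g j s k)"
        by (rule sum.swap)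
      finally show ?thesis
        unfolding contract3_act2
          contract3_axis_right[of T x "\<chi> s. \<Sum>j\<in>UNIV. w (Inr (j, s)) * y $ j"]
        by (simp only: vec_lambda_beta sum_distrib_right sum_distrib_left)
    qed
    ultimately show ?thesis
      by (simp add: sum_split contraction_form_def contract3_add distrib_left sum.distrib)
  qed
  have two: "(\<Sum>u\<in>UNIV. (of_bool (u = (p, q)) + of_bool (u = (q, p))) * F u) = F (p, q) + F (q, p)"
    for F :: "'b::finite \<times> 'b \<Rightarrow> complex" and p q
    by (simp add: distrib_right sum.distrib of_bool_def if_distrib[where f = "\<lambda>c. c * _"] cong: if_cong)
  have skew_rows:
    "(\<Sum>c\<in>UNIV. A (Inr (Inl (p, q))) c T * w c) = w (Inl (p, q)) + w (Inl (q, p))"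
    "(\<Sum>c\<in>UNIV. A (Inr (Inr (p', q'))) c T * w c) = w (Inr (p', q')) + w (Inr (q', p'))" for p q p' q' T w
    by (simp_all add: sum_split' A_def two)
  have rows: "(\<forall>r. (\<Sum>c\<in>UNIV. A r c T * w c) = 0) \<longleftrightarrow>
      skew (\<lambda>p q. w (Inl (p, q))) \<and> skew (\<lambda>p q. w (Inr (p, q))) \<and>
      (\<forall>x y. contraction_form T (act1 (\<lambda>p q. w (Inl (p, q))) T + act2 (\<lambda>p q. w (Inr (p, q))) T) x y = 0)"
    for T w
    unfolding split_sum_all split_paired_all row skew_rows skew_def
    by (auto simp: row skew_rows add_eq_0_iff2)
  have "\<exists>f. polynomial_fun f \<and> f T\<^sub>1 \<noteq> 0 \<and> (\<forall>T. f T \<noteq> 0 \<longrightarrow>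
      (\<forall>w. (\<forall>r. (\<Sum>c\<in>UNIV. A r c T * w c) = 0) \<longrightarrow> (\<forall>c\<in>UNIV. w c = 0)))"
  proof (rule generic_injective)
    fix w c assume w: "\<And>r. (\<Sum>c\<in>UNIV. A r c T\<^sub>1 * w c) = 0"
    then have "(\<forall>p q. w (Inl (p, q)) = 0) \<and> (\<forall>p q. w (Inr (p, q)) = 0)"
      using assms rows[of T\<^sub>1 w] unfolding trivial_stabiliser_def by blast
    then show "w c = 0" by (cases c) auto
  qed (auto intro: polyA)
  then obtain f where f: "polynomial_fun f" "f T\<^sub>1 \<noteq> 0"
    and inj: "\<And>T w c. f T \<noteq> 0 \<Longrightarrow> (\<forall>r. (\<Sum>c\<in>UNIV. A r c T * w c) = 0) \<Longrightarrow> w c = 0"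
    by blast
  have "trivial_stabiliser T" if "f T \<noteq> 0" for T
    unfolding trivial_stabiliser_def
  proof (intro allI impI)
    fix m :: "'i \<Rightarrow> 'i \<Rightarrow> complex" and n :: "'j \<Rightarrow> 'j \<Rightarrow> complex"
    assume mn: "skew m \<and> skew n \<and> (\<forall>x y. contraction_form T (act1 m T + act2 n T) x y = 0)"
    define w where "w = case_sum (case_prod m) (case_prod n)"
    have "\<forall>r. (\<Sum>c\<in>UNIV. A r c T * w c) = 0"
      unfolding rows using mn by (simp add: w_def)
    from inj[OF that this] have "w (Inl (p, q)) = 0" "w (Inr (p', q')) = 0" for p q p' q' by blast+
    then show "(\<forall>p q. m p q = 0) \<and> (\<forall>p q. n p q = 0)" by (simp add: w_def)
  qed
  with f show ?thesis by blast
qed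

section \<open>The strict inclusion\<close>

lemma proj_subspace_memD:
  assumes "vec.subspace W" "proj_point v \<in> proj_subspace W"
  shows "v \<in> W"
proof -
  obtain u where u: "u \<in> W" "proj_point v = proj_point u"
    using assms(2) unfolding proj_subspace_def by blast
  have "v \<in> vec.span {v}" by (simp add: vec.span_base)
  also have "\<dots> = vec.span {u}" using u(2) unfolding proj_point_def .
  also have "\<dots> \<subseteq> W" using u(1) assms(1) by (simp add: vec.span_minimal)
  finally show ?thesis .
qed

lemma tensor_prod_nonzero:
  assumes "x \<noteq> 0" "y \<noteq> 0" "z \<noteq> 0"
  shows "tensor_prod x y z \<noteq> 0"
proof -
  obtain i j k where "x $ i \<noteq> 0" "y $ j \<noteq> 0" "z $ k \<noteq> 0"
    using assms by (auto simp: vec_eq_iff)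
  then have "tensor_prod x y z $ (i, j, k) \<noteq> 0" by simp
  then show ?thesis by (metis zero_index)
qed

lemma proj_span_singular_points_subset:
  assumes "vec.subspace W"
    and "\<And>x y z. singular_vector_triple T x y z \<Longrightarrow> tensor_prod x y z \<in> W"
  shows "proj_span (singular_points T) \<subseteq> proj_subspace W"
proof -
  have "proj_point (tensor_prod x y z) \<in> proj_subspace W" if "singular_vector_triple T x y z" for x y z
    using assms(2)[OF that] that tensor_prod_nonzero
    unfolding proj_subspace_def singular_vector_triple_def by blast
  then have "singular_points T \<subseteq> proj_subspace W"
    unfolding singular_points_def by blast
  then show ?thesis
    using assms(1) unfolding proj_span_def by blast
qed

lemma pairing_tensor_prod:
  "pairing G (tensor_prod x y z) = (\<Sum>k\<in>UNIV. z $ k * contract3 G x y $ k)"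
proof -
  have "pairing G (tensor_prod x y z) =
      (\<Sum>i\<in>UNIV. \<Sum>j\<in>UNIV. \<Sum>k\<in>UNIV. z $ k * (G $ (i, j, k) * x $ i * y $ j))"
    by (simp add: pairing_def sum_UNIV_triple mult_ac)
  also have "\<dots> = (\<Sum>i\<in>UNIV. \<Sum>k\<in>UNIV. \<Sum>j\<in>UNIV. z $ k * (G $ (i, j, k) * x $ i * y $ j))"
    by (intro sum.cong refl sum.swap)
  also have "\<dots> = (\<Sum>k\<in>UNIV. \<Sum>i\<in>UNIV. \<Sum>j\<in>UNIV. z $ k * (G $ (i, j, k) * x $ i * y $ j))"
    by (rule sum.swap)
  finally show ?thesis by (simp add: contract3_def sum_distrib_left)
qed

text \<open>As the contraction is nonzero, the dependence relation makes \<open>z\<close> a multiple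
  of it, and the pairing becomes a multiple of the contraction form.\<close>

lemma singular_triple_annihilated:
  assumes "singular_vector_triple T x y z" "contract3 T x y \<noteq> 0"
    and "contraction_form T G x y = 0"
  shows "pairing G (tensor_prod x y z) = 0"
proof -
  obtain \<alpha> \<beta> where ab: "\<alpha> \<noteq> 0 \<or> \<beta> \<noteq> 0" "\<alpha> *s contract3 T x y + \<beta> *s z = 0"
    using assms(1) unfolding singular_vector_triple_def lin_dep_pair_def by blast
  have e: "\<beta> * z $ k = - \<alpha> * contract3 T x y $ k" for k
    using arg_cong[OF ab(2), of "\<lambda>v. v $ k"] by (simp add: add_eq_0_iff)
  have "\<beta> \<noteq> 0"
  proof
    assume "\<beta> = 0"
    with ab have "contract3 T x y = 0" by (simp add: vec_eq_iff)
    with assms(2) show False by simp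
  qed
  have "\<beta> * pairing G (tensor_prod x y z) = (\<Sum>k\<in>UNIV. (\<beta> * z $ k) * contract3 G x y $ k)"
    by (simp add: pairing_tensor_prod sum_distrib_left mult.assoc)
  also have "\<dots> = - \<alpha> * contraction_form T G x y"
    unfolding e contraction_form_def by (simp add: sum_distrib_left mult.assoc)
  finally show ?thesis using assms(3) \<open>\<beta> \<noteq> 0\<close> by simp
qed

lemma contraction_form_act3:
  assumes "skew r"
  shows "contraction_form T (G + act3 r T) x y = contraction_form T G x y"
  using skew_quadratic_form[OF assms, of "\<lambda>k. contract3 T x y $ k"]
  by (simp add: contraction_form_def contract3_add contract3_act3 distrib_left sum.distrib)

text \<open>An extra equation \<open>G\<close> holds on all singular points but is no combination of
  critical equations, so some vector of the critical space violates it.\<close>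

lemma proj_span_strict:
  fixes T :: "('i::finite, 'j::finite, 'k::finite) tensor"
  assumes card: "(CARD('i) * CARD('i) + CARD('i)) * (CARD('j) * CARD('j) + CARD('j))
      + 2 * (CARD('k) * CARD('k)) < 4 * (CARD('i) * CARD('j) * CARD('k)) + 2 * CARD('k)"
    and kernel: "\<And>x y. contract3 T x y = 0 \<Longrightarrow> x = 0 \<or> y = 0"
    and stab: "trivial_stabiliser T"
  shows "proj_span (singular_points T) \<subset> proj_subspace (critical_space T)"
proof -
  obtain G where G: "\<And>x y. contraction_form T G x y = 0" "\<And>r. skew r \<Longrightarrow> G \<noteq> act3 r T"
    using exists_extra_equation[OF card] by blast
  \<comment> \<open>The third-mode part does not affect the form, so the first two parts would
    preserve it infinitesimally and vanish, leaving \<open>G = act3 r T\<close>, which is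
    excluded.\<close>
  have "G \<notin> critical_equations T"
  proof
    assume "G \<in> critical_equations T"
    then obtain m n r where eq: "G = act1 m T + act2 n T + act3 r T" and sk: "skew m" "skew n" "skew r"
      unfolding critical_equations_def by blast
    have "contraction_form T (act1 m T + act2 n T) x y = 0" for x y
      using G(1)[of x y] unfolding eq contraction_form_act3[OF sk(3)] .
    then have "\<forall>p q. m p q = 0" "\<forall>p q. n p q = 0"
      using stab sk(1,2) unfolding trivial_stabiliser_def by blast+
    then have "G = act3 r T" by (simp add: eq vec_eq_iff)
    with G(2)[OF sk(3)] show False by blast
  qed
  then obtain z where z: "\<And>e. e \<in> critical_equations T \<Longrightarrow> pairing e z = 0" "pairing G z \<noteq> 0"
    using separating_pairing[OF subspace_critical_equations] by blast
  have zH: "z \<in> critical_space T" using z(1) by (rule critical_spaceI)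
  define W where "W = critical_space T \<inter> {v. pairing G v = 0}"
  have W: "vec.subspace W"
    unfolding W_def using subspace_annihilator[of "{G}"]
    by (intro vec.subspace_inter subspace_critical_space) simp
  have "proj_span (singular_points T) \<subseteq> proj_subspace W"
  proof (rule proj_span_singular_points_subset[OF W])
    fix x y v assume s: "singular_vector_triple T x y v"
    then have "contract3 T x y \<noteq> 0" using kernel[of x y] by (auto simp: singular_vector_triple_def)
    then show "tensor_prod x y v \<in> W"
      using tensor_prod_critical[OF s] singular_triple_annihilated[OF s _ G(1)] by (simp add: W_def)
  qed
  moreover have "proj_subspace W \<subseteq> proj_subspace (critical_space T)"
    unfolding proj_subspace_def W_def by blast
  moreover have "proj_point z \<in> proj_subspace (critical_space T)"
  proof -
    have "z \<noteq> 0" using z(2) by (metis pairing_zero_right)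
    then show ?thesis unfolding proj_subspace_def using zH by blast
  qed
  moreover have "proj_point z \<notin> proj_subspace W"
  proof -
    have "z \<notin> W" using z(2) unfolding W_def by simp
    then show ?thesis using proj_subspace_memD[OF W] by blast
  qed
  ultimately show ?thesis by blast
qed

theorem corollary6p2:
  fixes a b :: nat
  assumes "(a, b) \<in> {(2, 2), (2, 3), (2, 4)}"
    and "CARD('i::finite) = a + 1"
    and "CARD('j::finite) = b + 1"
    and "CARD('k::finite) = a + b + 2"
  shows "holds_for_general (\<lambda>T :: ('i, 'j, 'k) tensor.
           proj_span (singular_points T) \<subset> proj_subspace (critical_space T))"
proof -
  have i: "CARD('i) = 3" and k: "CARD('k) = b + 4" using assms by auto
  \<comment> \<open>With these dimensions the inequality amounts to
    \<open>(b + 3) * (b + 4) < 12 * (b + 1)\<close>; at \<open>b = 5\<close> both sides equal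
    72.\<close>
  have card: "(CARD('i) * CARD('i) + CARD('i)) * (CARD('j) * CARD('j) + CARD('j))
      + 2 * (CARD('k) * CARD('k)) < 4 * (CARD('i) * CARD('j) * CARD('k)) + 2 * CARD('k)"
    using assms(1) unfolding i k assms(3) by auto
  obtain f :: "('i, 'j, 'k) tensor \<Rightarrow> complex" and T\<^sub>0 where f: "polynomial_fun f" "f T\<^sub>0 \<noteq> 0"
    and kernel: "\<And>T x y. f T \<noteq> 0 \<Longrightarrow> contract3 T x y = 0 \<Longrightarrow> x = 0 \<or> y = 0"
    using generic_no_rank_one_kernel[where ?'i = 'i and ?'j = 'j and ?'k = 'k, OF i assms(3)] k by auto
  obtain T\<^sub>1 :: "('i, 'j, 'k) tensor" where "trivial_stabiliser T\<^sub>1"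
    using exists_trivial_stabiliser[where ?'i = 'i and ?'j = 'j and ?'k = 'k] i k assms(1,3) by auto
  then obtain g :: "('i, 'j, 'k) tensor \<Rightarrow> complex" where g: "polynomial_fun g" "g T\<^sub>1 \<noteq> 0"
    and stab: "\<And>T. g T \<noteq> 0 \<Longrightarrow> trivial_stabiliser T"
    using generic_trivial_stabiliser by blast
  obtain T\<^sub>2 where "f T\<^sub>2 * g T\<^sub>2 \<noteq> 0"
    using polynomial_fun_mult_nonzero[OF f(1) g(1) f(2) g(2)] by blast
  with polynomial_fun.mult[OF f(1) g(1)] show ?thesis
  proof (rule holds_for_generalI)
    fix T assume "f T * g T \<noteq> 0"
    then show "proj_span (singular_points T) \<subset> proj_subspace (critical_space T)"
      by (intro proj_span_strict card stab) (auto dest: kernel)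
  qed
qed

end
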